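(* Let $H$ be a complex Hilbert space, $A\in B(H)$ a normal operator with spectral measure $E_A$, and $U\subset\mathbb{C}$ an open set with $\sigma(A)\subseteq U$. Let $p_1,\dots,p_K$ be holomorphic functions on $U$ with $\sup_{\lambda\in\sigma(A)}|p_k(\lambda)|\le 1$ for each $k$, let $f:=p_K\circ\cdots\circ p_1$, and let $f^m$ be the $m$-fold composition of $f$ with itself (all these compositions being defined on a neighbourhood of $\sigma(A)$). Put $A^{(m)}:=f^m(A)$. Then: (i) For each finite $m\ge 1$, $\sigma(A^{(m)})=\sigma(f^m(A))=f^m(\sigma(A))$. (ii) If $f^m\to\chi$ pointwise on $\sigma(A)$ with $\sup_m\|f^m\|_\infty<\infty$, so that the strong operator limit $A^{(\omega)}:=\lim_{m\to\infty}A^{(m)}=\chi(A)$ exists, then $\sigma(A^{(\omega)})\subseteq\overline{\chi(\sigma(A))}$. In particular, if $\chi$ takes values only in $\{0,1\}$ (so that $A^{(\omega)}=P$ is a projection), then $\sigma(A^{(\omega)})\subseteq\{0,1\}$, and in fact $\sigma(P)=\{0,1\}$ unless $P=0$ or $P=I$.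
   Context: $\|g\|_\infty:=\sup_{\lambda\in\sigma(A)}|g(\lambda)|$. For a bounded Borel function $g$ on $\sigma(A)$, $g(A)=\int g\,dE_A$ is the Borel functional calculus of the normal operator $A$. *)

theory Defs
  imports "HOL-Analysis.Analysis"
begin

text \<open>Complex Hilbert spaces. The inner product is conjugate-linear in the first argument.\<close>

class chilbert_space = banach +
  fixes scaleC :: "complex \<Rightarrow> 'a \<Rightarrow> 'a" (infixr "*\<^sub>C" 75)
    and cinner :: "'a \<Rightarrow> 'a \<Rightarrow> complex"
  assumes scaleC_add_right: "c *\<^sub>C (x + y) = c *\<^sub>C x + c *\<^sub>C y"
    and scaleC_add_left: "(c + d) *\<^sub>C x = c *\<^sub>C x + d *\<^sub>C x"
    and scaleC_scaleC: "c *\<^sub>C (d *\<^sub>C x) = (c * d) *\<^sub>C x"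
    and scaleR_scaleC: "r *\<^sub>R x = complex_of_real r *\<^sub>C x"
    and cinner_commute: "cinner x y = cnj (cinner y x)"
    and cinner_add_right: "cinner x (y + z) = cinner x y + cinner x z"
    and cinner_scaleC_right: "cinner x (c *\<^sub>C y) = c * cinner x y"
    and norm_eq_sqrt_cinner: "norm x = sqrt (Re (cinner x x))"

instantiation complex :: chilbert_space
begin

definition scaleC_complex :: "complex \<Rightarrow> complex \<Rightarrow> complex" where
  "scaleC_complex c x = c * x"

definition cinner_complex :: "complex \<Rightarrow> complex \<Rightarrow> complex" where
  "cinner_complex x y = cnj x * y"

instance
  by standard
    (auto simp: scaleC_complex_def cinner_complex_def algebra_simps scaleR_conv_of_real
      cmod_def power2_eq_square)

end

definition bounded_clinear :: "('a::chilbert_space \<Rightarrow> 'a) \<Rightarrow> bool" where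
  "bounded_clinear A \<longleftrightarrow> bounded_linear A \<and> (\<forall>c x. A (c *\<^sub>C x) = c *\<^sub>C A x)"

definition cadjoint :: "('a::chilbert_space \<Rightarrow> 'a) \<Rightarrow> 'a \<Rightarrow> 'a" where
  "cadjoint A = (THE B. \<forall>x y. cinner (A x) y = cinner x (B y))"

definition normal_op :: "('a::chilbert_space \<Rightarrow> 'a) \<Rightarrow> bool" where
  "normal_op A \<longleftrightarrow> bounded_clinear A \<and> A \<circ> cadjoint A = cadjoint A \<circ> A"

definition orth_projection :: "('a::chilbert_space \<Rightarrow> 'a) \<Rightarrow> bool" where
  "orth_projection P \<longleftrightarrow> bounded_clinear P \<and> P \<circ> P = P \<and> cadjoint P = P"

definition op_spectrum :: "('a::chilbert_space \<Rightarrow> 'a) \<Rightarrow> complex set" where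
  "op_spectrum A =
    {l. \<not> (\<exists>B. bounded_clinear B \<and> (\<lambda>x. A x - l *\<^sub>C x) \<circ> B = id \<and> B \<circ> (\<lambda>x. A x - l *\<^sub>C x) = id)}"

definition strong_op_limit :: "(nat \<Rightarrow> 'a::chilbert_space \<Rightarrow> 'a) \<Rightarrow> ('a \<Rightarrow> 'a) \<Rightarrow> bool" where
  "strong_op_limit X T \<longleftrightarrow> (\<forall>x. (\<lambda>m. X m x) \<longlonglongrightarrow> T x)"

text \<open>Of the measure \<open>M\<close> below only the underlying measurable space is used.\<close>

definition projection_valued_measure ::
    "'b measure \<Rightarrow> ('b set \<Rightarrow> 'a::chilbert_space \<Rightarrow> 'a) \<Rightarrow> bool" where
  "projection_valued_measure M E \<longleftrightarrow>
     (\<forall>S\<in>sets M. orth_projection (E S)) \<and>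
     E {} = (\<lambda>x. 0) \<and> E (space M) = id \<and>
     (\<forall>S\<in>sets M. \<forall>T\<in>sets M. E (S \<inter> T) = E S \<circ> E T) \<and>
     (\<forall>F :: nat \<Rightarrow> 'b set. range F \<subseteq> sets M \<longrightarrow> disjoint_family F \<longrightarrow>
        (\<forall>x. (\<lambda>n. E (F n) x) sums E (\<Union>n. F n) x))"

definition pvm_diag :: "'b measure \<Rightarrow> ('b set \<Rightarrow> 'a::chilbert_space \<Rightarrow> 'a) \<Rightarrow> 'a \<Rightarrow> 'b measure" where
  "pvm_diag M E x = measure_of (space M) (sets M) (\<lambda>S. ennreal (Re (cinner x (E S x))))"

text \<open>
  \<open>\<integral> g dE\<close> in the weak sense, for bounded measurable \<open>g\<close>: the operator \<open>T\<close> with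
  \<open>\<langle>x, T x\<rangle> = \<integral> g d\<langle>x, E x\<rangle>\<close> for all \<open>x\<close>. By polarisation the diagonal determines \<open>T\<close>, and
  only positive measures are needed.
\<close>

definition pvm_integral ::
    "'b measure \<Rightarrow> ('b set \<Rightarrow> 'a::chilbert_space \<Rightarrow> 'a) \<Rightarrow> ('b \<Rightarrow> complex) \<Rightarrow> 'a \<Rightarrow> 'a" where
  "pvm_integral M E g =
     (THE T. bounded_clinear T \<and> (\<forall>x. cinner x (T x) = (\<integral>l. g l \<partial>pvm_diag M E x)))"

definition spectral_borel :: "('a::chilbert_space \<Rightarrow> 'a) \<Rightarrow> complex measure" where
  "spectral_borel A = restrict_space borel (op_spectrum A)"

definition borel_calculus ::
    "('a::chilbert_space \<Rightarrow> 'a) \<Rightarrow> (complex set \<Rightarrow> 'a \<Rightarrow> 'a) \<Rightarrow> (complex \<Rightarrow> complex) \<Rightarrow> 'a \<Rightarrow> 'a" where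
  "borel_calculus A E g = pvm_integral (spectral_borel A) E g"

definition spectral_measure_of ::
    "('a::chilbert_space \<Rightarrow> 'a) \<Rightarrow> (complex set \<Rightarrow> 'a \<Rightarrow> 'a) \<Rightarrow> bool" where
  "spectral_measure_of A E \<longleftrightarrow>
     projection_valued_measure (spectral_borel A) E \<and> borel_calculus A E (\<lambda>z. z) = A"

text \<open>Extended-valued, so that the supremum is meaningful for unbounded \<open>g\<close> and for empty \<open>S\<close>.\<close>

definition sup_norm_on :: "complex set \<Rightarrow> (complex \<Rightarrow> complex) \<Rightarrow> ennreal" where
  "sup_norm_on S g = (SUP l\<in>S. ennreal (cmod (g l)))"

text \<open>\<open>p K \<circ> \<dots> \<circ> p 1\<close>.\<close>

definition comp_chain :: "(nat \<Rightarrow> complex \<Rightarrow> complex) \<Rightarrow> nat \<Rightarrow> complex \<Rightarrow> complex" where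
  "comp_chain p K = fold p [1..<Suc K]"

text \<open>
  Natural domains, when each \<open>p k\<close> is regarded as a partial function with domain \<open>U\<close>, and \<open>f\<close>
  as a partial function with domain \<open>D\<close>.
\<close>

definition comp_chain_dom :: "complex set \<Rightarrow> (nat \<Rightarrow> complex \<Rightarrow> complex) \<Rightarrow> nat \<Rightarrow> complex set" where
  "comp_chain_dom U p K = {z. \<forall>k<K. comp_chain p k z \<in> U}"

definition natural_iterate_domain :: "complex set \<Rightarrow> (complex \<Rightarrow> complex) \<Rightarrow> nat \<Rightarrow> complex set" where
  "natural_iterate_domain D f m = {z. \<forall>i<m. (f ^^ i) z \<in> D}"

end

theory Submission
  imports Defs
begin

text \<open>
  For a projection-valued measure \<open>E\<close> put \<open>\<mu> x = \<langle>x, E(\<cdot>) x\<rangle>\<close>. For simple \<open>g\<close> the operator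
  \<open>\<Phi> g = \<integral> g dE\<close> satisfies \<open>\<parallel>\<Phi> g x\<parallel>\<^sup>2 = \<integral> |g|\<^sup>2 d\<mu> x\<close>, so dominated convergence
  extends \<open>\<Phi>\<close> to all bounded measurable \<open>g\<close>, gives strong continuity under bounded pointwise limits,
  and, by polarising the isometry, makes \<open>\<Phi>\<close> a *-homomorphism. If \<open>z\<close> has positive distance from
  the values of \<open>g\<close>, then \<open>\<Phi> (1 / (g - z))\<close> inverts \<open>\<Phi> g - z\<close>; hence the spectrum of \<open>\<Phi> g\<close> lies
  in the closure of the range of \<open>g\<close>. Conversely, \<open>E\<close> does not vanish on any neighbourhood of a point
  \<open>l\<close> of the spectrum of \<open>A\<close>, and unit vectors in the range of \<open>E\<close> of small neighbourhoods are
  approximate eigenvectors of \<open>\<Phi> g\<close> for the value \<open>g l\<close> when \<open>g\<close> is continuous. Since the spectrum of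
  \<open>A\<close> is compact, the two inclusions give the spectral mapping theorem for continuous \<open>g\<close>.
\<close>

section \<open>Complex Hilbert spaces\<close>

lemma scaleC_zero_right [simp]: "c *\<^sub>C (0::'a::chilbert_space) = 0"
  using scaleC_add_right[of c "0::'a" 0] by simp

lemma scaleC_zero_left [simp]: "0 *\<^sub>C (x::'a::chilbert_space) = 0"
  using scaleC_add_left[of 0 0 x] by simp

lemma scaleC_one [simp]: "1 *\<^sub>C (x::'a::chilbert_space) = x"
  using scaleR_scaleC[of 1 x] by simp

lemma scaleC_minus_left [simp]: "(- c) *\<^sub>C x = - (c *\<^sub>C (x::'a::chilbert_space))"
  using scaleC_add_left[of c "- c" x] by (simp add: eq_neg_iff_add_eq_0 add.commute)

lemma scaleC_diff_left: "(c - d) *\<^sub>C x = c *\<^sub>C x - d *\<^sub>C (x::'a::chilbert_space)"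
  using scaleC_add_left[of c "- d" x] by simp

lemma cinner_add_left: "cinner (x + y) z = cinner x z + cinner (y::'a::chilbert_space) z"
  by (metis cinner_commute cinner_add_right complex_cnj_add)

lemma cinner_scaleC_left: "cinner (c *\<^sub>C x) y = cnj c * cinner (x::'a::chilbert_space) y"
  by (metis cinner_commute cinner_scaleC_right complex_cnj_mult)

lemma cinner_zero_right [simp]: "cinner (x::'a::chilbert_space) 0 = 0"
  using cinner_add_right[of x 0 0] by simp

lemma cinner_zero_left [simp]: "cinner 0 (x::'a::chilbert_space) = 0"
  using cinner_add_left[of 0 0 x] by simp

lemma cinner_minus_right [simp]: "cinner x (- y) = - cinner (x::'a::chilbert_space) y"
  using cinner_add_right[of x y "- y"] by (simp add: eq_neg_iff_add_eq_0 add.commute)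

lemma cinner_diff_right: "cinner x (y - z) = cinner x y - cinner (x::'a::chilbert_space) z"
  using cinner_add_right[of x y "- z"] by simp

lemma cinner_sum_right:
  "cinner x (\<Sum>i\<in>I. y i) = (\<Sum>i\<in>I. cinner x (y i :: 'a::chilbert_space))"
  by (induction I rule: infinite_finite_induct) (auto simp: cinner_add_right)

lemma cinner_sum_left:
  "cinner (\<Sum>i\<in>I. x i) y = (\<Sum>i\<in>I. cinner (x i :: 'a::chilbert_space) y)"
  by (induction I rule: infinite_finite_induct) (auto simp: cinner_add_left)

text \<open>Positivity is hidden in the class axiom for the norm: \<open>sqrt\<close> is negative on
  negative reals, so \<open>norm x \<ge> 0\<close> forces \<open>Re (cinner x x) \<ge> 0\<close>.
  Conjugate symmetry removes the imaginary part.\<close>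

lemma cinner_self: "cinner x x = of_real ((norm (x::'a::chilbert_space))\<^sup>2)"
proof -
  have "0 \<le> Re (cinner x x)"
    using norm_ge_zero[of x] unfolding norm_eq_sqrt_cinner by simp
  moreover have "Im (cinner x x) = 0"
    using arg_cong[OF cinner_commute[of x x], of Im] by simp
  ultimately show ?thesis
    by (simp add: complex_eq_iff norm_eq_sqrt_cinner)
qed

lemma norm_scaleC [simp]: "norm (c *\<^sub>C x) = cmod c * norm (x::'a::chilbert_space)"
proof -
  have "cinner (c *\<^sub>C x) (c *\<^sub>C x) = of_real ((cmod c)\<^sup>2 * (norm x)\<^sup>2)"
    unfolding of_real_mult complex_norm_square
    by (simp add: cinner_scaleC_left cinner_scaleC_right cinner_self[of x])
  then have "(norm (c *\<^sub>C x))\<^sup>2 = (cmod c * norm x)\<^sup>2"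
    by (simp only: cinner_self of_real_eq_iff power_mult_distrib)
  then show ?thesis by (simp add: power2_eq_iff_nonneg)
qed

lemma norm_add_sq:
  "(norm (x + y :: 'a::chilbert_space))\<^sup>2 = (norm x)\<^sup>2 + (norm y)\<^sup>2 + 2 * Re (cinner x y)"
proof -
  have "cinner (x + y) (x + y) = cinner x x + cinner y y + (cinner x y + cnj (cinner x y))"
    by (simp add: cinner_add_left cinner_add_right flip: cinner_commute)
  from arg_cong[OF this, of Re] show ?thesis by (simp add: cinner_self)
qed

text \<open>Together with rotation by \<open>\<i>\<close>, this reduces continuity of the inner
  product, and later the polarised isometry, to statements about norms.\<close>

lemma Re_cinner_polar:
  "Re (cinner x (y::'a::chilbert_space)) = ((norm (x + y))\<^sup>2 - (norm (x - y))\<^sup>2) / 4"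
  using norm_add_sq[of x y] norm_add_sq[of x "- y"] by simp

lemma Im_cinner_eq_Re: "Im (cinner x (y::'a::chilbert_space)) = Re (cinner (\<i> *\<^sub>C x) y)"
  by (simp add: cinner_scaleC_left)

lemma tendsto_scaleC [tendsto_intros]:
  assumes "(f \<longlongrightarrow> (x::'a::chilbert_space)) F"
  shows "((\<lambda>t. c *\<^sub>C f t) \<longlongrightarrow> c *\<^sub>C x) F"
proof -
  have "bounded_linear (\<lambda>x::'a. c *\<^sub>C x)"
    by (rule bounded_linear_intro[where K = "cmod c"])
      (auto simp: scaleC_add_right scaleR_scaleC scaleC_scaleC mult.commute)
  from bounded_linear.tendsto[OF this assms] show ?thesis .
qed

lemma tendsto_cinner:
  assumes "(f \<longlongrightarrow> (x::'a::chilbert_space)) F" "(g \<longlongrightarrow> y) F"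
  shows "((\<lambda>t. cinner (f t) (g t)) \<longlongrightarrow> cinner x y) F"
  unfolding tendsto_complex_iff Im_cinner_eq_Re Re_cinner_polar
  by (intro conjI tendsto_intros assms) simp_all

section \<open>Bounded complex-linear operators\<close>

lemma bounded_clinearD:
  assumes "bounded_clinear T"
  shows "T (x + y) = T x + T y" "T (c *\<^sub>C x) = c *\<^sub>C T x" "bounded_linear T"
    "T 0 = 0" "T (x - y) = T x - T y" "T (- x) = - T x"
  using assms unfolding bounded_clinear_def
  by (auto simp: linear_simps)

lemma bounded_clinearI:
  assumes "\<And>x y. T (x + y) = T x + T y" "\<And>c x. T (c *\<^sub>C x) = c *\<^sub>C T x"
    "\<And>x. norm (T x) \<le> norm x * C"
  shows "bounded_clinear T"
  unfolding bounded_clinear_def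
  by (auto intro!: bounded_linear_intro[of T C] simp: assms scaleR_scaleC)

lemma bounded_clinear_bound:
  assumes "bounded_clinear T"
  obtains C where "0 < C" "\<And>x. norm (T x) \<le> norm x * C"
  using bounded_linear.pos_bounded[OF bounded_clinearD(3)[OF assms]] by auto

lemma bounded_clinear_id [simp]: "bounded_clinear id" "bounded_clinear (\<lambda>x. x)"
  by (rule bounded_clinearI[where C = 1]; simp)+

lemma bounded_clinear_zero [simp]: "bounded_clinear (\<lambda>x. 0)"
  by (rule bounded_clinearI[where C = 0]; simp)

lemma bounded_clinear_compose:
  assumes "bounded_clinear S" "bounded_clinear T"
  shows "bounded_clinear (S \<circ> T)"
  using assms unfolding bounded_clinear_def
  by (auto simp: o_def intro: bounded_linear_compose)

lemma bounded_clinear_add: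
  assumes "bounded_clinear S" "bounded_clinear T"
  shows "bounded_clinear (\<lambda>x. S x + T x)"
  using assms unfolding bounded_clinear_def
  by (auto simp: scaleC_add_right intro: bounded_linear_add)

lemma bounded_clinear_scaleC:
  assumes "bounded_clinear T"
  shows "bounded_clinear (\<lambda>x. c *\<^sub>C T x)"
proof -
  obtain C where "\<And>x. norm (T x) \<le> norm x * C"
    using bounded_clinear_bound[OF assms] by metis
  then have "cmod c * norm (T x) \<le> norm x * (C * cmod c)" for x
    using mult_left_mono[of "norm (T x)" "norm x * C" "cmod c"] by (simp add: mult_ac)
  then show ?thesis
    by (intro bounded_clinearI[where C = "C * cmod c"])
      (auto simp: bounded_clinearD[OF assms] scaleC_add_right scaleC_scaleC mult.commute)
qed

lemma bounded_clinear_diff: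
  assumes "bounded_clinear S" "bounded_clinear T"
  shows "bounded_clinear (\<lambda>x. S x - T x)"
  using bounded_clinear_add[OF assms(1) bounded_clinear_scaleC[OF assms(2), of "- 1"]] by simp

lemma bounded_clinear_sum:
  assumes "\<And>i. i \<in> I \<Longrightarrow> bounded_clinear (T i)"
  shows "bounded_clinear (\<lambda>x. \<Sum>i\<in>I. T i x)"
  using assms by (induction I rule: infinite_finite_induct) (auto intro: bounded_clinear_add)

lemma bounded_clinear_LIMSEQ:
  assumes "\<And>n. bounded_clinear (S n)" "\<And>x. (\<lambda>n. S n x) \<longlonglongrightarrow> T x"
    and "\<And>x. norm (T x) \<le> norm x * C"
  shows "bounded_clinear T"
proof (rule bounded_clinearI[OF _ _ assms(3)])
  show "T (x + y) = T x + T y" for x y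
    using tendsto_add[OF assms(2)[of x] assms(2)[of y]] assms(2)[of "x + y"]
    by (auto simp: bounded_clinearD[OF assms(1)] intro: LIMSEQ_unique)
  show "T (c *\<^sub>C x) = c *\<^sub>C T x" for c x
    using tendsto_scaleC[OF assms(2)[of x], of c] assms(2)[of "c *\<^sub>C x"]
    by (auto simp: bounded_clinearD[OF assms(1)] intro: LIMSEQ_unique)
qed

section \<open>Polarisation, Riesz representation and adjoints\<close>

lemma sesquilinear_eq_zero:
  fixes F :: "'a::chilbert_space \<Rightarrow> 'a \<Rightarrow> complex"
  assumes "\<And>x y z. F (x + y) z = F x z + F y z" "\<And>x y z. F x (y + z) = F x y + F x z"
    and "\<And>c x y. F (c *\<^sub>C x) y = cnj c * F x y" "\<And>c x y. F x (c *\<^sub>C y) = c * F x y"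
    and "\<And>x. F x x = 0"
  shows "F x y = 0"
proof -
  \<comment> \<open>The diagonal at \<open>x + y\<close> leaves the sum of the cross terms, the one
    at \<open>x + \<i> *\<^sub>C y\<close> their difference; both vanish.\<close>
  have "F x y + F y x = 0"
    using assms(5)[of "x + y"] unfolding assms(1,2) by (simp add: assms(5) add.commute)
  moreover have "\<i> * F x y - \<i> * F y x = 0"
    using assms(5)[of "x + \<i> *\<^sub>C y"] unfolding assms(1-4) by (simp add: assms(5))
  then have "F x y = F y x" by simp
  ultimately show ?thesis by simp
qed

text \<open>The form \<open>cinner x (S y - T y)\<close> has zero diagonal, so polarisation kills
  it. This is the uniqueness behind the description in \<open>pvm_integral\<close>.\<close>

lemma bounded_clinear_eqI:
  assumes "bounded_clinear S" "bounded_clinear T" "\<And>x. cinner x (S x) = cinner x (T x)"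
  shows "S = T"
proof
  fix y
  have "cinner x (S y - T y) = 0" for x
    by (rule sesquilinear_eq_zero[of "\<lambda>x y. cinner x (S y - T y)"])
      (simp_all add: bounded_clinearD[OF assms(1)] bounded_clinearD[OF assms(2)] assms(3)
        cinner_add_left cinner_add_right cinner_diff_right cinner_scaleC_left
        cinner_scaleC_right algebra_simps)
  from this[of "S y - T y"] show "S y = T y" by (simp add: cinner_self)
qed

lemma cadjoint_eqI:
  assumes "\<And>x y. cinner (A x) y = cinner x (B y)"
  shows "cadjoint A = B"
  unfolding cadjoint_def
proof (rule the_equality)
  fix B' assume B': "\<forall>x y. cinner (A x) y = cinner x (B' y)"
  show "B' = B"
  proof
    fix y
    have "cinner (B' y - B y) (B' y - B y) = 0"
      using assms B' by (simp add: cinner_diff_right flip: assms)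
    then show "B' y = B y" by (simp add: cinner_self)
  qed
qed (use assms in auto)

text \<open>The representing vector is the minimiser of \<open>\<lambda>x. \<parallel>x\<parallel>\<^sup>2 - 2 Re (\<phi> x)\<close>; minimising sequences
  are Cauchy by the parallelogram law.\<close>

lemma riesz_representation:
  fixes \<phi> :: "'a::chilbert_space \<Rightarrow> complex"
  assumes lin: "bounded_linear \<phi>" and hom: "\<And>c x. \<phi> (c *\<^sub>C x) = c * \<phi> x"
  obtains z where "\<And>x. \<phi> x = cinner z x"
proof -
  define J where "J = (\<lambda>x. (norm x)\<^sup>2 - 2 * Re (\<phi> x))"
  obtain C where C: "\<And>x. cmod (\<phi> x) \<le> norm x * C"
    using bounded_linear.bounded[OF lin] by blast
  \<comment> \<open>Complete the square: \<open>J x\<close> is at least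
    \<open>(norm x - C)\<^sup>2 - C\<^sup>2\<close>.\<close>
  have J_ge: "- C\<^sup>2 \<le> J x" for x
  proof -
    have "Re (\<phi> x) \<le> norm x * C" using C[of x] complex_Re_le_cmod[of "\<phi> x"] by linarith
    moreover have "0 \<le> (norm x - C)\<^sup>2" by simp
    ultimately show ?thesis by (simp add: J_def power2_eq_square algebra_simps)
  qed
  define m where "m = (INF x. J x)"
  have bdd: "bdd_below (range J)" using J_ge by (auto intro!: bdd_belowI)
  have m_le: "m \<le> J x" for x unfolding m_def by (rule cINF_lower[OF bdd]) simp
  have "\<exists>x. J x < m + inverse (real (Suc n))" for n
  proof (rule ccontr)
    assume "\<not> ?thesis"
    then have "m + inverse (real (Suc n)) \<le> m"
      unfolding m_def by (intro cINF_greatest) (auto simp: not_less m_def)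
    then show False by simp
  qed
  then obtain X where X: "\<And>n. J (X n) < m + inverse (real (Suc n))" by metis
  \<comment> \<open>The midpoint \<open>w\<close> has \<open>J w \<ge> m\<close>, so the
    parallelogram law bounds the distance of two points by their excess of \<open>J\<close> over
    \<open>m\<close>.\<close>
  have par: "(norm (x - y))\<^sup>2 \<le> 2 * (J x - m) + 2 * (J y - m)" for x y
  proof -
    define w where "w = (1/2) *\<^sub>R (x + y)"
    have "4 * (norm w)\<^sup>2 = (norm (x + y))\<^sup>2"
      by (simp only: w_def norm_scaleR power_mult_distrib) (simp add: power2_eq_square)
    moreover have "(norm (x + y))\<^sup>2 + (norm (x - y))\<^sup>2 = 2 * (norm x)\<^sup>2 + 2 * (norm y)\<^sup>2"
      using norm_add_sq[of x y] norm_add_sq[of x "- y"] by simp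
    moreover have "4 * Re (\<phi> w) = 2 * Re (\<phi> x) + 2 * Re (\<phi> y)"
      by (simp add: w_def linear_simps[OF lin])
    ultimately show ?thesis
      using m_le[of w] unfolding J_def by argo
  qed
  have "Cauchy X"
  proof (rule metric_CauchyI)
    fix e :: real assume "0 < e"
    then obtain N where N: "inverse (real (Suc N)) < e\<^sup>2 / 4"
      using reals_Archimedean[of "e\<^sup>2 / 4"] by auto
    have "dist (X i) (X j) < e" if "N \<le> i" "N \<le> j" for i j
    proof -
      have "inverse (real (Suc i)) \<le> inverse (real (Suc N))"
        "inverse (real (Suc j)) \<le> inverse (real (Suc N))"
        using that by (auto intro: le_imp_inverse_le)
      then have "(norm (X i - X j))\<^sup>2 < e\<^sup>2"
        using par[of "X i" "X j"] X[of i] X[of j] N by argo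
      then show ?thesis using \<open>0 < e\<close> by (simp add: dist_norm power2_less_imp_less)
    qed
    then show "\<exists>N. \<forall>i\<ge>N. \<forall>j\<ge>N. dist (X i) (X j) < e" by blast
  qed
  then obtain z where z: "X \<longlonglongrightarrow> z" using Cauchy_convergent_iff convergent_def by blast
  have "(\<lambda>n. J (X n)) \<longlonglongrightarrow> J z"
    unfolding J_def by (intro tendsto_intros z bounded_linear.tendsto[OF lin])
  moreover have "(\<lambda>n. m + inverse (real (Suc n))) \<longlonglongrightarrow> m + 0"
    by (intro tendsto_intros LIMSEQ_inverse_real_of_nat)
  ultimately have "J z \<le> m"
    using LIMSEQ_le[of "\<lambda>n. J (X n)" "J z" "\<lambda>n. m + inverse (real (Suc n))" "m + 0"] X
    by (metis add.right_neutral less_imp_le)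
  then have min: "J z \<le> J x" for x using m_le[of x] by simp
  have Re_eq: "Re (\<phi> h) = Re (cinner z h)" for h
  proof -
    define d where "d = Re (cinner z h) - Re (\<phi> h)"
    \<comment> \<open>The right side is \<open>J (z + t *\<^sub>R h) - J z\<close>. Nonnegativity at
      its minimiser \<open>t = - d / (norm h)\<^sup>2\<close> forces \<open>d = 0\<close>.\<close>
    have quad: "0 \<le> t\<^sup>2 * (norm h)\<^sup>2 + 2 * t * d" for t
    proof -
      have "Re (cinner z (t *\<^sub>R h)) = t * Re (cinner z h)"
        by (simp add: scaleR_scaleC cinner_scaleC_right)
      then show ?thesis
        using min[of "z + t *\<^sub>R h"]
        by (simp add: J_def norm_add_sq linear_simps[OF lin] d_def power_mult_distrib algebra_simps)
    qed
    have "d = 0"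
    proof (cases "h = 0")
      case True
      then show ?thesis by (simp add: d_def linear_simps[OF lin])
    next
      case False
      have "0 \<le> - (d\<^sup>2 / (norm h)\<^sup>2)"
        using quad[of "- d / (norm h)\<^sup>2"] False by (simp add: field_simps power2_eq_square)
      then show ?thesis using False by (simp add: divide_le_0_iff not_less)
    qed
    then show ?thesis by (simp add: d_def)
  qed
  have "\<phi> x = cinner z x" for x
    using Re_eq[of x] Re_eq[of "\<i> *\<^sub>C x"] by (simp add: complex_eq_iff hom cinner_scaleC_right)
  then show thesis by (rule that)
qed

text \<open>With \<open>c\<close> as below, \<open>c *\<^sub>C y\<close> is the orthogonal
  projection of \<open>x\<close> onto the line through \<open>y\<close>; the remainder has squared
  norm \<open>(norm x)\<^sup>2 - r\<close>, which is nonnegative.\<close>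

lemma cauchy_schwarz: "cmod (cinner x y) \<le> norm x * norm (y::'a::chilbert_space)"
proof (cases "y = 0")
  case False
  define r where "r = (cmod (cinner x y))\<^sup>2 / (norm y)\<^sup>2"
  define c where "c = cnj (cinner x y) / of_real ((norm y)\<^sup>2)"
  have "cinner x (c *\<^sub>C y) = of_real r"
    using complex_norm_square[of "cinner x y"]
    by (simp add: c_def r_def cinner_scaleC_right mult.commute)
  moreover have "cmod c = cmod (cinner x y) / (norm y)\<^sup>2"
    unfolding c_def norm_divide norm_of_real by simp
  then have "(cmod c * norm y)\<^sup>2 = r"
    using False by (simp add: r_def power2_eq_square field_simps)
  moreover have "0 \<le> (norm (x - c *\<^sub>C y))\<^sup>2" by simp
  moreover have "(norm (x - c *\<^sub>C y))\<^sup>2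
      = (norm x)\<^sup>2 + (cmod c * norm y)\<^sup>2 - 2 * Re (cinner x (c *\<^sub>C y))"
    using norm_add_sq[of x "- (c *\<^sub>C y)"] by simp
  ultimately have "r \<le> (norm x)\<^sup>2" by (simp del: zero_le_power2)
  then have "(cmod (cinner x y))\<^sup>2 \<le> (norm x * norm y)\<^sup>2"
    using False by (simp add: r_def field_simps power_mult_distrib)
  then show ?thesis by (rule power2_le_imp_le) simp
qed simp

text \<open>\<open>cadjoint\<close> is a definite description, so an adjoint has to be exhibited.
  Riesz applied to the functional \<open>cinner y (A x)\<close> of \<open>x\<close> supplies its
  value at each \<open>y\<close>.\<close>

lemma cadjoint_cinner:
  assumes "bounded_clinear (A :: 'a::chilbert_space \<Rightarrow> 'a)"
  shows "cinner (A x) y = cinner x (cadjoint A y)"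
proof -
  have "\<exists>z. \<forall>x. cinner y (A x) = cinner z x" for y
  proof -
    obtain C where C: "0 < C" "\<And>x. norm (A x) \<le> norm x * C"
      using bounded_clinear_bound[OF assms] by metis
    have "bounded_linear (\<lambda>x. cinner y (A x))"
    proof (rule bounded_linear_intro[where K = "norm y * C"])
      show "cmod (cinner y (A x)) \<le> norm x * (norm y * C)" for x
        using order_trans[OF cauchy_schwarz[of y "A x"] mult_left_mono[OF C(2)[of x], of "norm y"]]
        by (simp add: mult_ac)
    qed (simp_all add: bounded_clinearD[OF assms] cinner_add_right cinner_scaleC_right
        scaleR_conv_of_real scaleR_scaleC[where 'a='a])
    then obtain z where "\<And>x. cinner y (A x) = cinner z x"
      by (rule riesz_representation)
        (simp_all add: bounded_clinearD[OF assms] cinner_scaleC_right)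
    then show ?thesis by blast
  qed
  then obtain B where B: "\<And>x y. cinner y (A x) = cinner (B y) x" by metis
  have *: "cinner (A x) y = cinner x (B y)" for x y
    by (metis B cinner_commute)
  with cadjoint_eqI[OF *] show ?thesis by simp
qed

section \<open>Integration against a projection-valued measure\<close>

lemma orth_projectionD:
  assumes "orth_projection P"
  shows "bounded_clinear P" "P (P x) = P x" "cinner (P x) y = cinner x (P y)"
  using assms cadjoint_cinner[of P x y] unfolding orth_projection_def
  by (auto dest: fun_cong[where x = x])

locale pvm =
  fixes M :: "'b measure" and E :: "'b set \<Rightarrow> 'a::chilbert_space \<Rightarrow> 'a"
  assumes pvm: "projection_valued_measure M E"
begin

abbreviation \<mu> :: "'a \<Rightarrow> 'b measure" where "\<mu> \<equiv> pvm_diag M E"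

lemma orth_projection_E: "S \<in> sets M \<Longrightarrow> orth_projection (E S)"
  using pvm by (auto simp: projection_valued_measure_def)

lemmas E_clinear = orth_projectionD(1)[OF orth_projection_E]
lemmas E_idem = orth_projectionD(2)[OF orth_projection_E]
lemmas E_selfadjoint = orth_projectionD(3)[OF orth_projection_E]

lemma E_empty [simp]: "E {} x = 0"
  using pvm by (simp add: projection_valued_measure_def)

lemma E_space [simp]: "E (space M) = id"
  using pvm by (simp add: projection_valued_measure_def)

lemma E_Int: "S \<in> sets M \<Longrightarrow> T \<in> sets M \<Longrightarrow> E (S \<inter> T) x = E S (E T x)"
  using pvm by (simp add: projection_valued_measure_def)

lemma E_sums:
  "range F \<subseteq> sets M \<Longrightarrow> disjoint_family F \<Longrightarrow> (\<lambda>n. E (F n) x) sums E (\<Union>n. F n) x"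
  using pvm unfolding projection_valued_measure_def by blast

lemma cinner_E_self:
  assumes "S \<in> sets M"
  shows "cinner x (E S x) = of_real ((norm (E S x))\<^sup>2)"
  by (metis assms E_idem E_selfadjoint cinner_self)

section \<open>The scalar measures of a projection-valued measure\<close>

lemma space_\<mu> [simp]: "space (\<mu> x) = space M"
  by (simp add: pvm_diag_def)

lemma sets_\<mu> [simp, measurable_cong]: "sets (\<mu> x) = sets M"
  by (simp add: pvm_diag_def sets.sigma_sets_eq)

text \<open>\<open>measure_of\<close> yields the prescribed set function once this is positive and
  countably additive. Additivity follows by passing the convergent sum of the
  \<open>E (F n) x\<close> through the inner product.\<close>

lemma emeasure_\<mu>:
  assumes "S \<in> sets M"
  shows "emeasure (\<mu> x) S = ennreal ((norm (E S x))\<^sup>2)"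
proof -
  let ?m = "\<lambda>S. ennreal (Re (cinner x (E S x)))"
  have "countably_additive (sets M) ?m"
  proof (rule countably_additiveI)
    fix F :: "nat \<Rightarrow> 'b set"
    assume F: "range F \<subseteq> sets M" "disjoint_family F" "\<Union> (range F) \<in> sets M"
    have "(\<lambda>n. Re (cinner x (E (F n) x))) sums Re (cinner x (E (\<Union>n. F n) x))"
      unfolding sums_def Re_sum[symmetric] cinner_sum_right[symmetric]
      by (intro tendsto_Re tendsto_cinner tendsto_const E_sums[unfolded sums_def] F)
    moreover have "0 \<le> Re (cinner x (E (F n) x))" for n
      using F(1) by (subst cinner_E_self) auto
    ultimately show "(\<Sum>i. ?m (F i)) = ?m (\<Union> (range F))"
      by (intro suminf_ennreal_eq) auto
  qed
  then have "emeasure (\<mu> x) S = ?m S"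
    unfolding pvm_diag_def
    by (intro emeasure_measure_of_sigma sets.sigma_algebra_axioms assms) (auto simp: positive_def)
  then show ?thesis by (simp add: cinner_E_self assms)
qed

lemma finite_measure_\<mu>: "finite_measure (\<mu> x)"
  by (rule finite_measureI) (simp add: emeasure_\<mu>)

lemma measure_\<mu>: "S \<in> sets M \<Longrightarrow> measure (\<mu> x) S = (norm (E S x))\<^sup>2"
  by (simp add: measure_def emeasure_\<mu>)

section \<open>Bounded measurable functions and their scalar integrals\<close>

definition bounded_measurable :: "('b \<Rightarrow> complex) \<Rightarrow> bool" where
  "bounded_measurable g \<longleftrightarrow> g \<in> borel_measurable M \<and> (\<exists>C. \<forall>l\<in>space M. cmod (g l) \<le> C)"

lemma bounded_measurableI:
  "g \<in> borel_measurable M \<Longrightarrow> (\<And>l. l \<in> space M \<Longrightarrow> cmod (g l) \<le> C) \<Longrightarrow> bounded_measurable g"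
  by (auto simp: bounded_measurable_def)

lemma bounded_measurableE:
  assumes "bounded_measurable g"
  obtains C where "0 \<le> C" "\<And>l. l \<in> space M \<Longrightarrow> cmod (g l) \<le> C"
proof -
  obtain C where "\<And>l. l \<in> space M \<Longrightarrow> cmod (g l) \<le> C"
    using assms by (auto simp: bounded_measurable_def)
  then show thesis by (intro that[of "max 0 C"]) (auto simp: le_max_iff_disj)
qed

lemma bounded_measurable_borel [measurable_dest]:
  "bounded_measurable g \<Longrightarrow> g \<in> borel_measurable M"
  by (simp add: bounded_measurable_def)

lemma bounded_measurable_const: "bounded_measurable (\<lambda>_. c)"
  by (rule bounded_measurableI[where C = "cmod c"]) auto

lemma bounded_measurable_indicator: "S \<in> sets M \<Longrightarrow> bounded_measurable (indicator S)"
  by (rule bounded_measurableI[where C = 1]) (auto simp: indicator_def)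

lemma bounded_measurable_add:
  assumes "bounded_measurable g" "bounded_measurable h"
  shows "bounded_measurable (\<lambda>l. g l + h l)"
proof -
  obtain C where C: "\<And>l. l \<in> space M \<Longrightarrow> cmod (g l) \<le> C"
    using bounded_measurableE[OF assms(1)] by metis
  obtain D where D: "\<And>l. l \<in> space M \<Longrightarrow> cmod (h l) \<le> D"
    using bounded_measurableE[OF assms(2)] by metis
  have "cmod (g l + h l) \<le> C + D" if "l \<in> space M" for l
    using norm_triangle_ineq[of "g l" "h l"] C[OF that] D[OF that] by simp
  with assms show ?thesis
    by (intro bounded_measurableI[where C = "C + D"]) (auto simp: bounded_measurable_borel)
qed

lemma bounded_measurable_mult:
  assumes "bounded_measurable g" "bounded_measurable h"
  shows "bounded_measurable (\<lambda>l. g l * h l)"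
proof -
  obtain C where "0 \<le> C" "\<And>l. l \<in> space M \<Longrightarrow> cmod (g l) \<le> C"
    using bounded_measurableE[OF assms(1)] by metis
  moreover obtain D where "\<And>l. l \<in> space M \<Longrightarrow> cmod (h l) \<le> D"
    using bounded_measurableE[OF assms(2)] by metis
  moreover note assms
  ultimately show ?thesis
    by (intro bounded_measurableI[where C = "C * D"])
      (auto simp: bounded_measurable_borel norm_mult intro!: mult_mono)
qed

lemma bounded_measurable_diff:
  assumes "bounded_measurable g" "bounded_measurable h"
  shows "bounded_measurable (\<lambda>l. g l - h l)"
  using bounded_measurable_add[OF assms(1)
      bounded_measurable_mult[OF bounded_measurable_const[of "- 1"] assms(2)]] by simp

lemma bounded_measurable_cnj:
  assumes "bounded_measurable g"
  shows "bounded_measurable (\<lambda>l. cnj (g l))"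
proof -
  have "(\<lambda>l. cnj (g l)) \<in> borel_measurable M"
    by (rule measurable_compose[OF bounded_measurable_borel[OF assms]])
      (intro borel_measurable_continuous_onI continuous_intros)
  then show ?thesis
    using assms by (auto simp: bounded_measurable_def)
qed

lemma integrable_\<mu>:
  fixes g :: "'b \<Rightarrow> 'c::{banach, second_countable_topology}"
  assumes "g \<in> borel_measurable M" "\<And>l. l \<in> space M \<Longrightarrow> norm (g l) \<le> C"
  shows "integrable (\<mu> x) g"
  by (rule finite_measure.integrable_const_bound[OF finite_measure_\<mu>, where B = C])
    (use assms in auto)

lemma integrable_bounded_measurable: "bounded_measurable g \<Longrightarrow> integrable (\<mu> x) g"
  by (metis bounded_measurableE bounded_measurable_borel integrable_\<mu>)

lemma integrable_cmod_sq:
  assumes "bounded_measurable g"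
  shows "integrable (\<mu> x) (\<lambda>l. (cmod (g l))\<^sup>2)"
proof -
  obtain C where "\<And>l. l \<in> space M \<Longrightarrow> cmod (g l) \<le> C"
    using assms by (meson bounded_measurableE)
  with assms show ?thesis
    by (intro integrable_\<mu>[where C = "C\<^sup>2"]) (auto simp: bounded_measurable_borel power_mono)
qed

lemma integral_cmod_sq_le:
  assumes "bounded_measurable g" "\<And>l. l \<in> space M \<Longrightarrow> cmod (g l) \<le> C"
  shows "(\<integral>l. (cmod (g l))\<^sup>2 \<partial>\<mu> x) \<le> (C * norm x)\<^sup>2"
proof -
  interpret finite_measure "\<mu> x" by (rule finite_measure_\<mu>)
  have "(\<integral>l. (cmod (g l))\<^sup>2 \<partial>\<mu> x) \<le> (\<integral>l. C\<^sup>2 \<partial>\<mu> x)"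
    by (intro integral_mono integrable_cmod_sq assms integrable_const power_mono)
      (use assms in auto)
  then show ?thesis by (simp add: measure_\<mu> power_mult_distrib mult.commute)
qed

section \<open>Construction of the operator integral\<close>

lemma integral_simple_function:
  fixes \<phi> :: "complex \<Rightarrow> 'c::{banach, second_countable_topology}"
  assumes "simple_function M s"
  shows "(\<integral>l. \<phi> (s l) \<partial>\<mu> x)
    = (\<Sum>c\<in>s ` space M. (norm (E (s -` {c} \<inter> space M) x))\<^sup>2 *\<^sub>R \<phi> c)"
proof -
  interpret finite_measure "\<mu> x" by (rule finite_measure_\<mu>)
  have fin: "finite (s ` space M)" and meas: "\<And>c. s -` {c} \<inter> space M \<in> sets M"
    using assms by (auto simp: simple_functionD)
  have ind: "integrable (\<mu> x) (indicator (s -` {c} \<inter> space M) :: 'b \<Rightarrow> real)" for c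
    by (rule integrable_real_indicator) (use meas in \<open>auto simp: emeasure_\<mu>\<close>)
  have int: "integrable (\<mu> x) (\<lambda>l. indicator (s -` {c} \<inter> space M) l *\<^sub>R \<phi> c)" for c
    by (rule integrable_scaleR_left) (rule ind)
  have scale: "(\<integral>l. indicator (s -` {c} \<inter> space M) l *\<^sub>R \<phi> c \<partial>\<mu> x)
      = (norm (E (s -` {c} \<inter> space M) x))\<^sup>2 *\<^sub>R \<phi> c" for c
    using meas[of c] by (subst integral_scaleR_left) (auto simp: ind measure_\<mu>)
  \<comment> \<open>Only the level set of the value \<open>s l\<close> contributes at
    \<open>l\<close>. The map \<open>\<phi>\<close> stays general to cover both the identity and the
    squared modulus.\<close>
  have "\<phi> (s l) = (\<Sum>c\<in>s ` space M. indicator (s -` {c} \<inter> space M) l *\<^sub>R \<phi> c)"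
    if "l \<in> space M" for l
  proof -
    have "(\<Sum>c\<in>s ` space M. indicator (s -` {c} \<inter> space M) l *\<^sub>R \<phi> c)
        = (\<Sum>c\<in>s ` space M. if c = s l then \<phi> c else 0)"
      using that by (intro sum.cong) (auto simp: indicator_def)
    then show ?thesis using that fin by simp
  qed
  then have "(\<integral>l. \<phi> (s l) \<partial>\<mu> x)
      = (\<integral>l. (\<Sum>c\<in>s ` space M. indicator (s -` {c} \<inter> space M) l *\<^sub>R \<phi> c) \<partial>\<mu> x)"
    by (intro Bochner_Integration.integral_cong) auto
  also have "\<dots> = (\<Sum>c\<in>s ` space M. (\<integral>l. indicator (s -` {c} \<inter> space M) l *\<^sub>R \<phi> c \<partial>\<mu> x))"
    by (intro Bochner_Integration.integral_sum int)
  also have "\<dots> = (\<Sum>c\<in>s ` space M. (norm (E (s -` {c} \<inter> space M) x))\<^sup>2 *\<^sub>R \<phi> c)"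
    by (simp only: scale)
  finally show ?thesis .
qed

text \<open>The last clause says that \<open>g \<mapsto> T x\<close> is an isometry of \<open>L\<^sup>2(\<mu> x)\<close>. It gives the passage
  to limits of simple functions and, after polarisation in \<open>g\<close>, multiplicativity.\<close>

definition represents :: "('b \<Rightarrow> complex) \<Rightarrow> ('a \<Rightarrow> 'a) \<Rightarrow> bool" where
  "represents g T \<longleftrightarrow> bounded_clinear T \<and> (\<forall>x. cinner x (T x) = (\<integral>l. g l \<partial>\<mu> x)) \<and>
     (\<forall>x. (norm (T x))\<^sup>2 = (\<integral>l. (cmod (g l))\<^sup>2 \<partial>\<mu> x))"

text \<open>The operator is the sum of the \<open>c *\<^sub>C E (S c)\<close> over the level sets
  \<open>S c\<close>. Disjointness makes the ranges orthogonal, and Pythagoras gives the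
  isometry.\<close>

lemma represents_simple_function:
  assumes "simple_function M s"
  shows "\<exists>T. represents s T"
proof -
  define S where "S c = s -` {c} \<inter> space M" for c
  define T where "T x = (\<Sum>c\<in>s ` space M. c *\<^sub>C E (S c) x)" for x
  have fin: "finite (s ` space M)" and meas: "\<And>c. S c \<in> sets M"
    using assms by (auto simp: simple_functionD S_def)
  have orth: "cinner (E (S c) x) (E (S d) x) = (if c = d then of_real ((norm (E (S c) x))\<^sup>2) else 0)"
    for c d x
  proof (cases "c = d")
    case False
    then have "S c \<inter> S d = {}" by (auto simp: S_def)
    then have "E (S c) (E (S d) x) = 0" using E_Int[OF meas meas, of c d x] by simp
    then show ?thesis using False by (simp add: E_selfadjoint[OF meas])
  qed (simp add: cinner_self)
  have "bounded_clinear T"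
    unfolding T_def by (intro bounded_clinear_sum bounded_clinear_scaleC E_clinear meas)
  moreover have "cinner x (T x) = (\<integral>l. s l \<partial>\<mu> x)" for x
    using integral_simple_function[OF assms, of x "\<lambda>c. c"]
    by (simp add: T_def cinner_sum_right cinner_scaleC_right cinner_E_self[OF meas] S_def[symmetric]
        scaleR_conv_of_real mult.commute)
  moreover have "(norm (T x))\<^sup>2 = (\<integral>l. (cmod (s l))\<^sup>2 \<partial>\<mu> x)" for x
  proof -
    have "cinner (T x) (T x)
        = (\<Sum>c\<in>s ` space M. \<Sum>d\<in>s ` space M. d * (cnj c * cinner (E (S c) x) (E (S d) x)))"
      unfolding T_def cinner_sum_left cinner_sum_right cinner_scaleC_left cinner_scaleC_right
      by (subst sum.swap) (simp add: sum_distrib_left)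
    also have "\<dots> = (\<Sum>c\<in>s ` space M. c * cnj c * of_real ((norm (E (S c) x))\<^sup>2))"
      unfolding orth using fin by (intro sum.cong refl) (simp add: if_distrib cong: if_cong)
    also have "\<dots> = of_real (\<integral>l. (cmod (s l))\<^sup>2 \<partial>\<mu> x)"
      using integral_simple_function[OF assms, of x "\<lambda>c. (cmod c)\<^sup>2"]
      by (simp add: S_def[symmetric] complex_norm_square[symmetric] mult.commute)
    finally show ?thesis by (simp only: cinner_self of_real_eq_iff)
  qed
  ultimately show ?thesis unfolding represents_def by blast
qed

lemma represents_unique:
  assumes "represents g T" "bounded_clinear T'" "\<And>x. cinner x (T' x) = (\<integral>l. g l \<partial>\<mu> x)"
  shows "T' = T"
  using assms by (intro bounded_clinear_eqI) (auto simp: represents_def)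

text \<open>Simple functions converge to \<open>g\<close> in L2 of every \<open>\<mu> x\<close>; the
  isometry transfers this to the vectors \<open>T n x\<close>, and every clause of
  \<open>represents\<close> survives the limit.\<close>

lemma represents_exists:
  assumes g: "bounded_measurable g"
  shows "\<exists>T. represents g T"
proof -
  obtain C where C: "0 \<le> C" "\<And>l. l \<in> space M \<Longrightarrow> cmod (g l) \<le> C"
    using g by (meson bounded_measurableE)
  have gm [measurable]: "g \<in> borel_measurable M" using g by (rule bounded_measurable_borel)
  \<comment> \<open>With base point 0 the approximants are at most twice \<open>g\<close> in
    modulus. This yields the dominating constants built from \<open>2 * C\<close> for
    \<open>s n\<close> and \<open>3 * C\<close> for \<open>s n - g\<close>.\<close>
  obtain s where s: "\<And>n. simple_function M (s n)"
      "\<And>l. l \<in> space M \<Longrightarrow> (\<lambda>n. s n l) \<longlonglongrightarrow> g l"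
      "\<And>n l. l \<in> space M \<Longrightarrow> dist (s n l) 0 \<le> 2 * dist (g l) 0"
    using borel_measurable_implies_sequence_metric[OF gm, of 0] by blast
  have sm [measurable]: "s n \<in> borel_measurable M" for n
    using s(1) by (rule borel_measurable_simple_function)
  have s_le: "cmod (s n l) \<le> 2 * C" if "l \<in> space M" for n l
    using s(3)[OF that, of n] C(2)[OF that] by simp
  have sb: "bounded_measurable (s n)" for n
    using sm s_le by (rule bounded_measurableI)
  obtain T where T: "\<And>n. represents (s n) (T n)"
    using represents_simple_function[OF s(1)] by metis
  then have Tc: "\<And>n. bounded_clinear (T n)" by (simp add: represents_def)
  \<comment> \<open>The difference of two simple functions is simple, and by uniqueness its operator
    is \<open>T n - T k\<close>; so the isometry applies to differences.\<close>
  have diff: "(norm (T n x - T k x))\<^sup>2 = (\<integral>l. (cmod (s n l - s k l))\<^sup>2 \<partial>\<mu> x)" for n k x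
  proof -
    obtain D where D: "represents (\<lambda>l. s n l - s k l) D"
      using represents_simple_function[OF simple_function_diff[OF s(1) s(1)]] by metis
    have "(\<lambda>x. T n x - T k x) = D"
      using T by (intro represents_unique[OF D])
        (auto simp: represents_def cinner_diff_right integrable_bounded_measurable sb
          intro: bounded_clinear_diff)
    then have "T n x - T k x = D x" by (rule fun_cong)
    then show ?thesis using D by (simp add: represents_def)
  qed
  have lim0: "(\<lambda>n. \<integral>l. (cmod (s n l - g l))\<^sup>2 \<partial>\<mu> x) \<longlonglongrightarrow> 0" for x
  proof -
    interpret finite_measure "\<mu> x" by (rule finite_measure_\<mu>)
    have "(\<lambda>n. \<integral>l. (cmod (s n l - g l))\<^sup>2 \<partial>\<mu> x) \<longlonglongrightarrow> (\<integral>l. 0 \<partial>\<mu> x)"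
    proof (rule integral_dominated_convergence[where w = "\<lambda>_. (3 * C)\<^sup>2"])
      show "AE l in \<mu> x. (\<lambda>n. (cmod (s n l - g l))\<^sup>2) \<longlonglongrightarrow> 0"
      proof (rule AE_I2)
        fix l assume "l \<in> space (\<mu> x)"
        then have "(\<lambda>n. (cmod (s n l - g l))\<^sup>2) \<longlonglongrightarrow> (cmod (g l - g l))\<^sup>2"
          by (intro tendsto_intros s(2)) simp
        then show "(\<lambda>n. (cmod (s n l - g l))\<^sup>2) \<longlonglongrightarrow> 0" by simp
      qed
      show "AE l in \<mu> x. norm ((cmod (s n l - g l))\<^sup>2) \<le> (3 * C)\<^sup>2" for n
      proof (rule AE_I2)
        fix l assume "l \<in> space (\<mu> x)"
        then have "cmod (s n l - g l) \<le> 3 * C"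
          using norm_triangle_ineq4[of "s n l" "g l"] s_le[of l n] C(2)[of l] by simp
        then have "(cmod (s n l - g l))\<^sup>2 \<le> (3 * C)\<^sup>2" by (intro power_mono) auto
        then show "norm ((cmod (s n l - g l))\<^sup>2) \<le> (3 * C)\<^sup>2" by simp
      qed
    qed auto
    then show ?thesis by simp
  qed
  have "Cauchy (\<lambda>n. T n x)" for x
  proof (rule metric_CauchyI)
    fix e :: real assume "0 < e"
    \<comment> \<open>In the bound \<open>pt\<close> two such integrals occur, each with factor
      2.\<close>
    then have "0 < e\<^sup>2 / 4" by simp
    from order_tendstoD(2)[OF lim0[of x] this]
    obtain N where N: "\<And>n. N \<le> n \<Longrightarrow> (\<integral>l. (cmod (s n l - g l))\<^sup>2 \<partial>\<mu> x) < e\<^sup>2 / 4"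
      by (auto simp: eventually_sequentially)
    have "dist (T n x) (T k x) < e" if "N \<le> n" "N \<le> k" for n k
    proof -
      note int = integrable_cmod_sq[OF bounded_measurable_diff]
      have pt: "(cmod (a - b))\<^sup>2 \<le> 2 * (cmod (a - c))\<^sup>2 + 2 * (cmod (b - c))\<^sup>2" for a b c
      proof -
        have "(cmod (a - b))\<^sup>2 \<le> (cmod (a - c) + cmod (b - c))\<^sup>2"
          using norm_triangle_ineq4[of "a - c" "b - c"] by (intro power_mono) auto
        also have "\<dots> \<le> 2 * (cmod (a - c))\<^sup>2 + 2 * (cmod (b - c))\<^sup>2"
          using sum_squares_bound[of "cmod (a - c)" "cmod (b - c)"]
          by (simp add: power2_sum)
        finally show ?thesis .
      qed
      have "(\<integral>l. (cmod (s n l - s k l))\<^sup>2 \<partial>\<mu> x)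
          \<le> (\<integral>l. 2 * (cmod (s n l - g l))\<^sup>2 + 2 * (cmod (s k l - g l))\<^sup>2 \<partial>\<mu> x)"
        by (intro integral_mono Bochner_Integration.integrable_add integrable_mult_right int sb g pt)
      also have "\<dots> = 2 * (\<integral>l. (cmod (s n l - g l))\<^sup>2 \<partial>\<mu> x) + 2 * (\<integral>l. (cmod (s k l - g l))\<^sup>2 \<partial>\<mu> x)"
        using int[OF sb g] by simp
      also have "\<dots> < e\<^sup>2" using N[OF that(1)] N[OF that(2)] by simp
      finally have "(norm (T n x - T k x))\<^sup>2 < e\<^sup>2" by (simp only: diff)
      then show ?thesis using \<open>0 < e\<close> by (simp add: dist_norm power2_less_imp_less)
    qed
    then show "\<exists>N. \<forall>n\<ge>N. \<forall>k\<ge>N. dist (T n x) (T k x) < e" by blast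
  qed
  then obtain R where R: "\<And>x. (\<lambda>n. T n x) \<longlonglongrightarrow> R x"
    unfolding Cauchy_convergent_iff convergent_def by metis
  have diag: "cinner x (R x) = (\<integral>l. g l \<partial>\<mu> x)" for x
  proof (rule LIMSEQ_unique)
    show "(\<lambda>n. cinner x (T n x)) \<longlonglongrightarrow> cinner x (R x)"
      by (intro tendsto_cinner tendsto_const R)
    have "(\<lambda>n. \<integral>l. s n l \<partial>\<mu> x) \<longlonglongrightarrow> (\<integral>l. g l \<partial>\<mu> x)"
    proof (rule integral_dominated_convergence[where w = "\<lambda>_. 2 * C"])
      show "integrable (\<mu> x) (\<lambda>_. 2 * C)"
        by (rule finite_measure.integrable_const[OF finite_measure_\<mu>])
    qed (use s(2) s_le in auto)
    then show "(\<lambda>n. cinner x (T n x)) \<longlonglongrightarrow> (\<integral>l. g l \<partial>\<mu> x)"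
      using T by (simp add: represents_def)
  qed
  have isom: "(norm (R x))\<^sup>2 = (\<integral>l. (cmod (g l))\<^sup>2 \<partial>\<mu> x)" for x
  proof (rule LIMSEQ_unique)
    show "(\<lambda>n. (norm (T n x))\<^sup>2) \<longlonglongrightarrow> (norm (R x))\<^sup>2"
      by (intro tendsto_intros R)
    have "(\<lambda>n. \<integral>l. (cmod (s n l))\<^sup>2 \<partial>\<mu> x) \<longlonglongrightarrow> (\<integral>l. (cmod (g l))\<^sup>2 \<partial>\<mu> x)"
    proof (rule integral_dominated_convergence[where w = "\<lambda>_. (2 * C)\<^sup>2"])
      show "integrable (\<mu> x) (\<lambda>_. (2 * C)\<^sup>2)"
        by (rule finite_measure.integrable_const[OF finite_measure_\<mu>])
      show "AE l in \<mu> x. (\<lambda>n. (cmod (s n l))\<^sup>2) \<longlonglongrightarrow> (cmod (g l))\<^sup>2"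
        using s(2) by (auto intro!: tendsto_intros)
      show "AE l in \<mu> x. norm ((cmod (s n l))\<^sup>2) \<le> (2 * C)\<^sup>2" for n
        using power_mono[OF s_le, of _ n 2] by auto
    qed auto
    then show "(\<lambda>n. (norm (T n x))\<^sup>2) \<longlonglongrightarrow> (\<integral>l. (cmod (g l))\<^sup>2 \<partial>\<mu> x)"
      using T by (simp add: represents_def)
  qed
  \<comment> \<open>The limiting isometry supplies the uniform bound that makes the strong limit
    \<open>R\<close> a bounded operator.\<close>
  have "norm (R x) \<le> norm x * C" for x
  proof (rule power2_le_imp_le)
    show "(norm (R x))\<^sup>2 \<le> (norm x * C)\<^sup>2"
      using integral_cmod_sq_le[OF g C(2), of x] by (simp add: isom mult.commute)
  qed (simp add: C(1))
  then have "bounded_clinear R"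
    by (rule bounded_clinear_LIMSEQ[OF Tc R])
  with diag isom show ?thesis unfolding represents_def by blast
qed

section \<open>Algebra of the functional calculus\<close>

abbreviation \<Phi> :: "('b \<Rightarrow> complex) \<Rightarrow> 'a \<Rightarrow> 'a" where "\<Phi> \<equiv> pvm_integral M E"

lemma
  assumes "bounded_measurable g"
  shows \<Phi>_clinear: "bounded_clinear (\<Phi> g)"
    and \<Phi>_diag: "cinner x (\<Phi> g x) = (\<integral>l. g l \<partial>\<mu> x)"
    and \<Phi>_norm: "(norm (\<Phi> g x))\<^sup>2 = (\<integral>l. (cmod (g l))\<^sup>2 \<partial>\<mu> x)"
    and \<Phi>_eqI: "bounded_clinear T \<Longrightarrow> (\<And>x. cinner x (T x) = (\<integral>l. g l \<partial>\<mu> x)) \<Longrightarrow> \<Phi> g = T"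
proof -
  obtain R where R: "represents g R" using represents_exists[OF assms] by blast
  have "\<Phi> g = R"
    unfolding pvm_integral_def
    by (rule the_equality) (use R represents_unique[OF R] in \<open>auto simp: represents_def\<close>)
  then show "bounded_clinear (\<Phi> g)" "cinner x (\<Phi> g x) = (\<integral>l. g l \<partial>\<mu> x)"
      "(norm (\<Phi> g x))\<^sup>2 = (\<integral>l. (cmod (g l))\<^sup>2 \<partial>\<mu> x)"
    using R by (auto simp: represents_def)
  show "\<Phi> g = T" if "bounded_clinear T" "\<And>x. cinner x (T x) = (\<integral>l. g l \<partial>\<mu> x)"
    using represents_unique[OF R that] \<open>\<Phi> g = R\<close> by simp
qed

lemma \<Phi>_cong:
  assumes "\<And>l. l \<in> space M \<Longrightarrow> g l = h l"
  shows "\<Phi> g = \<Phi> h"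
proof -
  have "(\<integral>l. g l \<partial>\<mu> x) = (\<integral>l. h l \<partial>\<mu> x)" for x
    by (intro Bochner_Integration.integral_cong) (auto simp: assms)
  then show ?thesis by (simp add: pvm_integral_def)
qed

lemma \<Phi>_add:
  assumes "bounded_measurable g" "bounded_measurable h"
  shows "\<Phi> (\<lambda>l. g l + h l) = (\<lambda>x. \<Phi> g x + \<Phi> h x)"
  by (rule \<Phi>_eqI)
    (simp_all add: assms bounded_measurable_add bounded_clinear_add \<Phi>_clinear \<Phi>_diag
      cinner_add_right integrable_bounded_measurable)

lemma \<Phi>_scaleC:
  assumes "bounded_measurable g"
  shows "\<Phi> (\<lambda>l. c * g l) = (\<lambda>x. c *\<^sub>C \<Phi> g x)"
  by (rule \<Phi>_eqI)
    (simp_all add: assms bounded_measurable_mult bounded_measurable_const bounded_clinear_scaleC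
      \<Phi>_clinear \<Phi>_diag cinner_scaleC_right)

lemma \<Phi>_diff:
  assumes "bounded_measurable g" "bounded_measurable h"
  shows "\<Phi> (\<lambda>l. g l - h l) = (\<lambda>x. \<Phi> g x - \<Phi> h x)"
  by (rule \<Phi>_eqI)
    (simp_all add: assms bounded_measurable_diff bounded_clinear_diff \<Phi>_clinear \<Phi>_diag
      cinner_diff_right integrable_bounded_measurable)

lemma \<Phi>_indicator:
  assumes "S \<in> sets M"
  shows "\<Phi> (indicator S) = E S"
proof (rule \<Phi>_eqI)
  interpret finite_measure "\<mu> x" for x by (rule finite_measure_\<mu>)
  show "bounded_measurable (indicator S)"
    by (rule bounded_measurable_indicator[OF assms])
  show "cinner x (E S x) = (\<integral>l. indicator S l \<partial>\<mu> x)" for x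
  proof -
    have "(\<integral>l. indicator S l \<partial>\<mu> x) = (\<integral>l. complex_of_real (indicator S l) \<partial>\<mu> x)"
      by (intro Bochner_Integration.integral_cong) (auto simp: indicator_def)
    also have "\<dots> = of_real (measure (\<mu> x) S)"
      using assms sets.sets_into_space[OF assms] by (simp add: Int_absorb2)
    finally show ?thesis by (simp add: cinner_E_self measure_\<mu> assms)
  qed
qed (use assms E_clinear in auto)

lemma \<Phi>_one: "\<Phi> (\<lambda>_. 1) = id"
  using \<Phi>_indicator[of "space M"] \<Phi>_cong[of "indicator (space M)" "\<lambda>_. 1"] by simp

lemma \<Phi>_diff_const:
  assumes "bounded_measurable g"
  shows "\<Phi> (\<lambda>l. g l - z) = (\<lambda>x. \<Phi> g x - z *\<^sub>C x)"
  using \<Phi>_diff[OF assms bounded_measurable_const, of z]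
    \<Phi>_scaleC[OF bounded_measurable_const, of z 1] by (simp add: \<Phi>_one)

text \<open>The difference of the two sides is sesquilinear, and its diagonal vanishes because
  integration commutes with conjugation.\<close>

lemma \<Phi>_adjoint:
  assumes "bounded_measurable g"
  shows "cinner (\<Phi> g x) y = cinner x (\<Phi> (\<lambda>l. cnj (g l)) y)"
proof -
  note g' = bounded_measurable_cnj[OF assms]
  have "cinner (\<Phi> g x) y - cinner x (\<Phi> (\<lambda>l. cnj (g l)) y) = 0"
  proof (rule sesquilinear_eq_zero[of "\<lambda>x y. cinner (\<Phi> g x) y - cinner x (\<Phi> (\<lambda>l. cnj (g l)) y)"])
    show "cinner (\<Phi> g x) x - cinner x (\<Phi> (\<lambda>l. cnj (g l)) x) = 0" for x
      unfolding cinner_commute[of "\<Phi> g x" x] \<Phi>_diag[OF assms] \<Phi>_diag[OF g'] by simp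
  qed (simp_all add: bounded_clinearD[OF \<Phi>_clinear[OF assms]] bounded_clinearD[OF \<Phi>_clinear[OF g']]
      cinner_add_left cinner_add_right cinner_scaleC_left cinner_scaleC_right algebra_simps)
  then show ?thesis by simp
qed

text \<open>Polarised isometry: the norms at \<open>g + h\<close> and \<open>g - h\<close> determine
  the real part.\<close>

lemma \<Phi>_cinner:
  assumes "bounded_measurable g" "bounded_measurable h"
  shows "cinner (\<Phi> g x) (\<Phi> h x) = (\<integral>l. cnj (g l) * h l \<partial>\<mu> x)"
proof -
  have int: "integrable (\<mu> x) (\<lambda>l. cnj (g l) * h l)"
    by (intro integrable_bounded_measurable bounded_measurable_mult bounded_measurable_cnj assms)
  \<comment> \<open>Stated for arbitrary \<open>g\<close>, so that the instance
    \<open>\<i> * g\<close> gives the imaginary part.\<close>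
  have Re: "Re (cinner (\<Phi> g x) (\<Phi> h x)) = (\<integral>l. Re (cnj (g l) * h l) \<partial>\<mu> x)"
    if g: "bounded_measurable g" for g
  proof -
    have "Re (cinner (\<Phi> g x) (\<Phi> h x))
        = ((\<integral>l. (cmod (g l + h l))\<^sup>2 \<partial>\<mu> x) - (\<integral>l. (cmod (g l - h l))\<^sup>2 \<partial>\<mu> x)) / 4"
      unfolding Re_cinner_polar \<Phi>_norm[OF bounded_measurable_add[OF g assms(2)], symmetric]
        \<Phi>_norm[OF bounded_measurable_diff[OF g assms(2)], symmetric]
      by (simp add: \<Phi>_add \<Phi>_diff g assms(2))
    also have "\<dots> = (\<integral>l. ((cmod (g l + h l))\<^sup>2 - (cmod (g l - h l))\<^sup>2) / 4 \<partial>\<mu> x)"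
      using g assms(2)
      by (simp add: integrable_cmod_sq bounded_measurable_add bounded_measurable_diff)
    also have "\<dots> = (\<integral>l. Re (cnj (g l) * h l) \<partial>\<mu> x)"
      by (intro Bochner_Integration.integral_cong)
        (auto simp only: cmod_power2, simp add: power2_eq_square algebra_simps)
    finally show ?thesis .
  qed
  have ig: "bounded_measurable (\<lambda>l. \<i> * g l)"
    by (intro bounded_measurable_mult bounded_measurable_const assms)
  have "Im (cinner (\<Phi> g x) (\<Phi> h x)) = (\<integral>l. Im (cnj (g l) * h l) \<partial>\<mu> x)"
    using Re[OF ig] unfolding Im_cinner_eq_Re \<Phi>_scaleC[OF assms(1)] by simp
  with Re[OF assms(1)] show ?thesis
    unfolding complex_eq_iff
      integral_bounded_linear[OF bounded_linear_Re int, symmetric]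
      integral_bounded_linear[OF bounded_linear_Im int, symmetric] by blast
qed

text \<open>Moving \<open>\<Phi> g\<close> across the inner product as an adjoint turns the diagonal
  of the composition into an instance of \<open>\<Phi>_cinner\<close>; the diagonal determines the
  operator.\<close>

lemma \<Phi>_mult:
  assumes "bounded_measurable g" "bounded_measurable h"
  shows "\<Phi> (\<lambda>l. g l * h l) = \<Phi> g \<circ> \<Phi> h"
proof (rule \<Phi>_eqI)
  note g' = bounded_measurable_cnj[OF assms(1)]
  show "cinner x ((\<Phi> g \<circ> \<Phi> h) x) = (\<integral>l. g l * h l \<partial>\<mu> x)" for x
    using \<Phi>_adjoint[OF g', of x "\<Phi> h x"] \<Phi>_cinner[OF g' assms(2), of x] by simp
qed (use assms in \<open>auto intro: bounded_measurable_mult bounded_clinear_compose \<Phi>_clinear\<close>)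

end

section \<open>Spectra\<close>

definition op_invertible :: "('a::chilbert_space \<Rightarrow> 'a) \<Rightarrow> bool" where
  "op_invertible T \<longleftrightarrow> (\<exists>B. bounded_clinear B \<and> T \<circ> B = id \<and> B \<circ> T = id)"

lemma op_invertibleI:
  "bounded_clinear B \<Longrightarrow> (\<And>x. T (B x) = x) \<Longrightarrow> (\<And>x. B (T x) = x) \<Longrightarrow> op_invertible T"
  unfolding op_invertible_def by (auto simp: fun_eq_iff)

lemma op_invertibleE:
  assumes "op_invertible T"
  obtains B C where "bounded_clinear B" "\<And>x. T (B x) = x" "\<And>x. B (T x) = x"
    "0 < C" "\<And>x. norm (B x) \<le> norm x * C"
  using assms unfolding op_invertible_def by (metis bounded_clinear_bound comp_apply id_apply)

lemma op_spectrum_iff: "l \<in> op_spectrum A \<longleftrightarrow> \<not> op_invertible (\<lambda>x. A x - l *\<^sub>C x)"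
  by (simp add: op_spectrum_def op_invertible_def)

text \<open>Solving \<open>S y + R y = x\<close> amounts to finding a fixed point of the contraction
  \<open>y \<mapsto> B (x - R y)\<close>.\<close>

lemma op_invertible_perturb:
  fixes S R B :: "'a::chilbert_space \<Rightarrow> 'a"
  assumes S: "bounded_clinear S" and R: "bounded_clinear R" and B: "bounded_clinear B"
    and SB: "\<And>x. S (B x) = x" and BS: "\<And>x. B (S x) = x"
    and q: "0 \<le> q" "q < 1" and contr: "\<And>x. norm (B (R x)) \<le> q * norm x"
  shows "op_invertible (\<lambda>x. S x + R x)"
proof -
  obtain C where C: "0 < C" "\<And>x. norm (B x) \<le> norm x * C"
    using bounded_clinear_bound[OF B] by metis
  note lin = bounded_clinearD[OF S] bounded_clinearD[OF R] bounded_clinearD[OF B]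
  have "\<exists>!y. B (x - R y) = y" for x
  proof -
    have "norm (B (x - R y) - B (x - R z)) \<le> q * norm (y - z)" for y z
    proof -
      have "B (x - R y) - B (x - R z) = B (R (z - y))" by (simp add: lin)
      then show ?thesis using contr[of "z - y"] by (simp add: norm_minus_commute)
    qed
    then have "\<exists>!y. y \<in> UNIV \<and> B (x - R y) = y"
      using Banach_fix[of UNIV q "\<lambda>y. B (x - R y)"] q by (auto simp: dist_norm complete_UNIV)
    then show ?thesis by simp
  qed
  moreover have "B (x - R y) = y \<longleftrightarrow> S y + R y = x" for x y
    by (metis SB BS diff_add_cancel add_diff_cancel_right')
  ultimately have ex1: "\<exists>!y. S y + R y = x" for x by simp
  then obtain D where D: "\<And>x. S (D x) + R (D x) = x" by metis
  \<comment> \<open>Uniqueness of solutions makes \<open>D\<close> additive, homogeneous and a left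
    inverse.\<close>
  have uniq: "D x = y" if "S y + R y = x" for x y
    using ex1[of x] D[of x] that by blast
  have "norm (D x) \<le> norm x * (C / (1 - q))" for x
  proof -
    have "D x = B x - B (R (D x))"
      using arg_cong[OF D[of x], of B] by (simp add: lin BS algebra_simps)
    then have "norm (D x) \<le> norm (B x) + norm (B (R (D x)))"
      by (metis norm_triangle_ineq4)
    \<comment> \<open>As \<open>q < 1\<close>, the last term can be absorbed on the left, giving the
      bound \<open>C / (1 - q)\<close>.\<close>
    then have "norm (D x) \<le> norm x * C + q * norm (D x)"
      using C(2)[of x] contr[of "D x"] by linarith
    then show ?thesis using q by (simp add: field_simps)
  qed
  moreover have "D (x + y) = D x + D y" for x y
  proof (rule uniq)
    have "S (D x + D y) + R (D x + D y) = (S (D x) + R (D x)) + (S (D y) + R (D y))"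
      by (simp add: lin algebra_simps)
    then show "S (D x + D y) + R (D x + D y) = x + y" by (simp only: D)
  qed
  moreover have "D (c *\<^sub>C x) = c *\<^sub>C D x" for c x
    by (rule uniq) (simp add: lin scaleC_add_right[symmetric] D)
  ultimately have "bounded_clinear D" by (intro bounded_clinearI)
  then show ?thesis by (rule op_invertibleI) (simp_all add: D uniq)
qed

section \<open>Compactness of the spectrum and the spectrum of a projection\<close>

lemma bounded_op_spectrum:
  assumes "bounded_clinear A"
  shows "bounded (op_spectrum A)"
proof -
  obtain C where C: "0 < C" "\<And>x. norm (A x) \<le> norm x * C"
    using bounded_clinear_bound[OF assms] by metis
  have "cmod l \<le> C" if l: "l \<in> op_spectrum A" for l
  proof (rule ccontr)
    assume *: "\<not> cmod l \<le> C"
    then have "0 < cmod l" using C(1) by linarith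
    then have "l \<noteq> 0" by auto
    \<comment> \<open>\<open>A - l\<close> perturbs the scalar operator \<open>- l\<close>, with
      contraction factor \<open>C / cmod l < 1\<close>.\<close>
    have "op_invertible (\<lambda>x. (- l) *\<^sub>C x + A x)"
    proof (rule op_invertible_perturb[where B = "\<lambda>x. (- 1 / l) *\<^sub>C x" and q = "C / cmod l"])
      show "norm ((- 1 / l) *\<^sub>C A x) \<le> C / cmod l * norm x" for x
        using C(2)[of x] \<open>0 < cmod l\<close> by (simp add: norm_divide field_simps)
    qed (use * C(1) \<open>l \<noteq> 0\<close> \<open>0 < cmod l\<close> assms bounded_clinear_scaleC[OF bounded_clinear_id(2)] in
        \<open>auto simp: scaleC_scaleC simp del: scaleC_minus_left\<close>)
    then show False using l by (simp add: op_spectrum_iff)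
  qed
  then show ?thesis by (auto simp: bounded_iff)
qed

text \<open>If the inverse of \<open>A - l\<close> is bounded by \<open>C\<close>, moving
  \<open>l\<close> by less than \<open>1 / C\<close> is a perturbation with contraction factor below
  1; hence the complement is open.\<close>

lemma closed_op_spectrum:
  assumes "bounded_clinear A"
  shows "closed (op_spectrum A)"
  unfolding closed_def open_dist
proof (intro ballI)
  fix l assume "l \<in> - op_spectrum A"
  then obtain B C where B: "bounded_clinear B" "\<And>x. A (B x) - l *\<^sub>C B x = x"
      "\<And>x. B (A x - l *\<^sub>C x) = x" "0 < C" "\<And>x. norm (B x) \<le> norm x * C"
    by (auto simp: op_spectrum_iff elim: op_invertibleE)
  have "l' \<in> - op_spectrum A" if "dist l' l < 1 / C" for l'
  proof -
    have "op_invertible (\<lambda>x. (A x - l *\<^sub>C x) + (l - l') *\<^sub>C x)"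
    proof (rule op_invertible_perturb[where B = B and q = "dist l' l * C"])
      show "norm (B ((l - l') *\<^sub>C x)) \<le> dist l' l * C * norm x" for x
        using B(5)[of "(l - l') *\<^sub>C x"] by (simp add: dist_norm norm_minus_commute mult_ac)
    qed (use that B assms in \<open>auto simp: field_simps
        intro: bounded_clinear_diff bounded_clinear_scaleC[OF bounded_clinear_id(2)]\<close>)
    then show ?thesis by (simp add: op_spectrum_iff scaleC_diff_left)
  qed
  then show "\<exists>e>0. \<forall>l'. dist l' l < e \<longrightarrow> l' \<in> - op_spectrum A"
    using B(4) by (intro exI[of _ "1 / C"]) auto
qed

lemma compact_op_spectrum: "bounded_clinear A \<Longrightarrow> compact (op_spectrum A)"
  by (simp add: compact_eq_bounded_closed bounded_op_spectrum closed_op_spectrum)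

text \<open>A left inverse of \<open>P\<close> would cancel one factor in
  \<open>P (P x) = P x\<close> and give \<open>P = id\<close>. Since \<open>P - id\<close> vanishes
  on the range of \<open>P\<close>, a left inverse of it would give \<open>P = 0\<close>.\<close>

lemma op_spectrum_projection:
  assumes P: "orth_projection P" "P \<noteq> (\<lambda>x. 0)" "P \<noteq> id"
  shows "{0, 1} \<subseteq> op_spectrum P"
proof -
  note idem = orth_projectionD(2)[OF P(1)]
  have "0 \<in> op_spectrum P"
  proof (rule ccontr)
    assume "0 \<notin> op_spectrum P"
    then have "op_invertible P" by (simp add: op_spectrum_iff)
    then obtain B where "\<And>x. B (P x) = x" by (metis op_invertibleE)
    then have "P x = x" for x by (metis idem)
    then show False using P(3) by auto
  qed
  moreover have "1 \<in> op_spectrum P"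
  proof (rule ccontr)
    assume "1 \<notin> op_spectrum P"
    then have "op_invertible (\<lambda>x. P x - x)" by (simp add: op_spectrum_iff)
    then obtain B C where B: "bounded_clinear B" "\<And>x. P (B x) - B x = x"
        "\<And>x. B (P x - x) = x" "0 < C" "\<And>x. norm (B x) \<le> norm x * C"
      by (auto elim: op_invertibleE)
    have "P x = 0" for x
      using B(3)[of "P x"] by (simp add: idem bounded_clinearD(4)[OF B(1)])
    then show False using P(2) by auto
  qed
  ultimately show ?thesis by simp
qed

section \<open>Spectra and limits in the functional calculus\<close>

context pvm
begin

lemma op_spectrum_\<Phi>_subset:
  assumes g: "bounded_measurable g"
  shows "op_spectrum (\<Phi> g) \<subseteq> closure (g ` space M)"
proof
  fix z assume z: "z \<in> op_spectrum (\<Phi> g)"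
  show "z \<in> closure (g ` space M)"
  proof (rule ccontr)
    assume "z \<notin> closure (g ` space M)"
    then obtain e where e: "0 < e" "\<And>l. l \<in> space M \<Longrightarrow> e \<le> dist (g l) z"
      by (auto simp: closure_approachable not_less)
    define h where "h l = 1 / (g l - z)" for l
    have h: "bounded_measurable h"
    proof (rule bounded_measurableI)
      show "h \<in> borel_measurable M"
        using bounded_measurable_borel[OF g] unfolding h_def by measurable
      show "cmod (h l) \<le> 1 / e" if "l \<in> space M" for l
        using e(1) e(2)[OF that] by (simp add: h_def norm_divide dist_norm frac_le)
    qed
    have gz: "bounded_measurable (\<lambda>l. g l - z)"
      by (intro bounded_measurable_diff g bounded_measurable_const)
    have "g l \<noteq> z" if "l \<in> space M" for l
      using e(1) e(2)[OF that] by auto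
    then have "\<Phi> (\<lambda>l. (g l - z) * h l) = id" "\<Phi> (\<lambda>l. h l * (g l - z)) = id"
      unfolding \<Phi>_one[symmetric] by (intro \<Phi>_cong; simp add: h_def)+
    then have "op_invertible (\<lambda>x. \<Phi> g x - z *\<^sub>C x)"
      unfolding \<Phi>_mult[OF gz h] \<Phi>_mult[OF h gz] \<Phi>_diff_const[OF g]
      by (intro op_invertibleI[of "\<Phi> h"] \<Phi>_clinear h) (simp_all add: fun_eq_iff)
    then show False using z by (simp add: op_spectrum_iff)
  qed
qed

text \<open>If \<open>E\<close> vanished on this set, \<open>1 / (g - z)\<close> could be replaced
  by 0 there; the result is bounded by \<open>1 / e\<close>, and its operator would still invert
  \<open>\<Phi> g - z\<close>.\<close>

lemma E_nonzero_near_spectrum: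
  assumes g: "bounded_measurable g" and z: "z \<in> op_spectrum (\<Phi> g)" and e: "0 < e"
  shows "\<exists>x. E (g -` ball z e \<inter> space M) x \<noteq> 0"
proof (rule ccontr)
  define S where "S = g -` ball z e \<inter> space M"
  assume "\<not> ?thesis"
  then have ES: "E S = (\<lambda>x. 0)" by (auto simp: S_def)
  have gm [measurable]: "g \<in> borel_measurable M" by (rule bounded_measurable_borel[OF g])
  have S [measurable]: "S \<in> sets M" unfolding S_def by measurable
  define h where "h l = (if l \<in> S then 0 else 1 / (g l - z))" for l
  have h: "bounded_measurable h"
  proof (rule bounded_measurableI)
    show "h \<in> borel_measurable M" unfolding h_def by measurable
    show "cmod (h l) \<le> 1 / e" if "l \<in> space M" for l
      using e that by (auto simp: h_def S_def norm_divide dist_norm norm_minus_commute frac_le)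
  qed
  have gz: "bounded_measurable (\<lambda>l. g l - z)"
    by (intro bounded_measurable_diff g bounded_measurable_const)
  note ind = bounded_measurable_indicator[OF S]
  \<comment> \<open>The product of \<open>g - z\<close> and \<open>h\<close> is 1 only off
    \<open>S\<close>, which suffices because the indicator of \<open>S\<close> integrates to
    \<open>E S = 0\<close>.\<close>
  have "\<Phi> (\<lambda>l. 1 - indicator S l) = id"
    using \<Phi>_diff[OF bounded_measurable_const[of 1] ind] by (auto simp: \<Phi>_one \<Phi>_indicator S ES)
  moreover have "g l \<noteq> z" if "l \<in> space M" "l \<notin> S" for l
    using e that by (auto simp: S_def)
  then have "\<Phi> (\<lambda>l. (g l - z) * h l) = \<Phi> (\<lambda>l. 1 - indicator S l)"
      "\<Phi> (\<lambda>l. h l * (g l - z)) = \<Phi> (\<lambda>l. 1 - indicator S l)"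
    by (intro \<Phi>_cong; simp add: h_def)+
  ultimately have "op_invertible (\<lambda>x. \<Phi> g x - z *\<^sub>C x)"
    unfolding \<Phi>_mult[OF gz h] \<Phi>_mult[OF h gz] \<Phi>_diff_const[OF g]
    by (intro op_invertibleI[of "\<Phi> h"] \<Phi>_clinear h) (simp_all add: fun_eq_iff)
  then show False using z by (simp add: op_spectrum_iff)
qed

text \<open>A vector in the range of \<open>E S\<close> is an approximate eigenvector for the value that \<open>g\<close> nearly
  takes on \<open>S\<close>.\<close>

lemma op_spectrum_\<Phi>I:
  assumes g: "bounded_measurable g"
    and near: "\<And>e. 0 < e \<Longrightarrow> \<exists>S\<in>sets M. (\<exists>x. E S x \<noteq> 0) \<and> (\<forall>l\<in>S. cmod (g l - z) \<le> e)"
  shows "z \<in> op_spectrum (\<Phi> g)"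
proof (rule ccontr)
  assume "z \<notin> op_spectrum (\<Phi> g)"
  then have "op_invertible (\<lambda>x. \<Phi> g x - z *\<^sub>C x)" by (simp add: op_spectrum_iff)
  then obtain B C where "bounded_clinear B" "\<And>x. \<Phi> g (B x) - z *\<^sub>C B x = x"
      and B: "\<And>x. B (\<Phi> g x - z *\<^sub>C x) = x" "0 < C" "\<And>x. norm (B x) \<le> norm x * C"
    by (auto elim: op_invertibleE)
  \<comment> \<open>The tolerance is matched to the bound \<open>C\<close> of the inverse, so that
    the final estimate reads \<open>norm y \<le> norm y / 2\<close>.\<close>
  then obtain S x where S: "S \<in> sets M" "E S x \<noteq> 0" "\<And>l. l \<in> S \<Longrightarrow> cmod (g l - z) \<le> 1 / (2 * C)"
    using near[of "1 / (2 * C)"] by auto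
  have gz: "bounded_measurable (\<lambda>l. g l - z)"
    by (intro bounded_measurable_diff g bounded_measurable_const)
  note ind = bounded_measurable_indicator[OF S(1)]
  note k = bounded_measurable_mult[OF gz ind]
  define y where "y = E S x"
  have y: "E S y = y" by (simp add: y_def E_idem S(1))
  have "\<Phi> g y - z *\<^sub>C y = \<Phi> (\<lambda>l. g l - z) y"
    by (simp add: \<Phi>_diff_const g)
  \<comment> \<open>Since \<open>E S\<close> fixes \<open>y\<close>, the function
    \<open>g - z\<close> may be cut off to \<open>S\<close>, where it is small.\<close>
  also have "\<dots> = \<Phi> (\<lambda>l. (g l - z) * indicator S l) y"
    using y by (simp add: \<Phi>_mult[OF gz ind] \<Phi>_indicator S(1))
  finally have eq: "\<Phi> g y - z *\<^sub>C y = \<Phi> (\<lambda>l. (g l - z) * indicator S l) y" .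
  have "(norm (\<Phi> g y - z *\<^sub>C y))\<^sup>2 \<le> (1 / (2 * C) * norm y)\<^sup>2"
    unfolding eq \<Phi>_norm[OF k] using S(3) B(2)
    by (intro integral_cmod_sq_le k) (auto simp: indicator_def)
  then have "norm (\<Phi> g y - z *\<^sub>C y) \<le> 1 / (2 * C) * norm y"
    by (rule power2_le_imp_le) (use B(2) in auto)
  then have "norm (\<Phi> g y - z *\<^sub>C y) * C \<le> norm y / 2"
    using B(2) by (simp add: field_simps)
  then have "norm y \<le> norm y / 2"
    using B(3)[of "\<Phi> g y - z *\<^sub>C y"] unfolding B(1) by linarith
  then show False using S(2) by (simp add: y_def)
qed

text \<open>The isometry turns the squared distance of the vectors into the integral of
  \<open>(cmod (gn n l - g l))\<^sup>2\<close>; on a finite measure a constant dominates it.\<close>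

lemma \<Phi>_strong_limit:
  assumes gn: "\<And>n. bounded_measurable (gn n)" and g: "bounded_measurable g"
    and lim: "\<And>l. l \<in> space M \<Longrightarrow> (\<lambda>n. gn n l) \<longlonglongrightarrow> g l"
    and bd: "\<And>n l. l \<in> space M \<Longrightarrow> cmod (gn n l) \<le> C"
  shows "(\<lambda>n. \<Phi> (gn n) x) \<longlonglongrightarrow> \<Phi> g x"
proof -
  have [measurable]: "g \<in> borel_measurable M" "\<And>n. gn n \<in> borel_measurable M"
    by (auto intro: bounded_measurable_borel gn g)
  obtain D where D: "\<And>l. l \<in> space M \<Longrightarrow> cmod (g l) \<le> D"
    using bounded_measurableE[OF g] by metis
  have "(\<lambda>n. \<integral>l. (cmod (gn n l - g l))\<^sup>2 \<partial>\<mu> x) \<longlonglongrightarrow> (\<integral>l. 0 \<partial>\<mu> x)"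
  proof (rule integral_dominated_convergence[where w = "\<lambda>_. (C + D)\<^sup>2"])
    show "integrable (\<mu> x) (\<lambda>_. (C + D)\<^sup>2)"
      by (rule finite_measure.integrable_const[OF finite_measure_\<mu>])
    show "AE l in \<mu> x. (\<lambda>n. (cmod (gn n l - g l))\<^sup>2) \<longlonglongrightarrow> 0"
    proof (rule AE_I2)
      fix l assume "l \<in> space (\<mu> x)"
      then have "(\<lambda>n. (cmod (gn n l - g l))\<^sup>2) \<longlonglongrightarrow> (cmod (g l - g l))\<^sup>2"
        by (intro tendsto_intros lim) simp
      then show "(\<lambda>n. (cmod (gn n l - g l))\<^sup>2) \<longlonglongrightarrow> 0" by simp
    qed
    show "AE l in \<mu> x. norm ((cmod (gn n l - g l))\<^sup>2) \<le> (C + D)\<^sup>2" for n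
    proof (rule AE_I2)
      fix l assume "l \<in> space (\<mu> x)"
      then have "cmod (gn n l - g l) \<le> C + D"
        using norm_triangle_ineq4[of "gn n l" "g l"] bd[of l n] D[of l] by simp
      then have "(cmod (gn n l - g l))\<^sup>2 \<le> (C + D)\<^sup>2" by (intro power_mono) auto
      then show "norm ((cmod (gn n l - g l))\<^sup>2) \<le> (C + D)\<^sup>2" by simp
    qed
  qed auto
  then have "(\<lambda>n. (norm (\<Phi> (gn n) x - \<Phi> g x))\<^sup>2) \<longlonglongrightarrow> 0"
    unfolding \<Phi>_norm[OF bounded_measurable_diff[OF gn g], symmetric] by (simp add: \<Phi>_diff gn g)
  from tendsto_real_sqrt[OF this] show ?thesis
    by (simp add: tendsto_norm_zero_iff LIM_zero_iff)
qed

lemma \<Phi>_orth_projection: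
  assumes g: "bounded_measurable g" and "\<And>l. l \<in> space M \<Longrightarrow> g l \<in> {0, 1}"
  shows "orth_projection (\<Phi> g)"
proof -
  have "\<Phi> g \<circ> \<Phi> g = \<Phi> g"
    unfolding \<Phi>_mult[OF g g, symmetric] by (rule \<Phi>_cong) (use assms(2) in auto)
  moreover have "\<Phi> (\<lambda>l. cnj (g l)) = \<Phi> g"
    by (rule \<Phi>_cong) (use assms(2) in fastforce)
  then have "cadjoint (\<Phi> g) = \<Phi> g"
    using \<Phi>_adjoint[OF g] by (intro cadjoint_eqI) simp
  ultimately show ?thesis
    using \<Phi>_clinear[OF g] by (simp add: orth_projection_def)
qed

end

section \<open>Continuity of the compositions on their natural domains\<close>

lemma comp_chain_Suc: "comp_chain p (Suc k) = p (Suc k) \<circ> comp_chain p k"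
  by (simp add: comp_chain_def)

text \<open>The domain keeps every value before stage \<open>K\<close> inside \<open>U\<close>,
  where the next map is continuous. The separate index \<open>j\<close> lets the induction run on
  one fixed domain.\<close>

lemma continuous_on_comp_chain:
  assumes "\<And>k. k \<in> {1..K} \<Longrightarrow> continuous_on U (p k)" and "j \<le> K"
  shows "continuous_on (comp_chain_dom U p K) (comp_chain p j)"
  using \<open>j \<le> K\<close>
proof (induction j)
  case 0
  then show ?case by (simp add: comp_chain_def)
next
  case (Suc j)
  then show ?case
    unfolding comp_chain_Suc
    by (intro continuous_on_compose Suc.IH continuous_on_subset[OF assms(1)])
      (auto simp: comp_chain_dom_def)
qed

lemma continuous_on_funpow:
  assumes "continuous_on D f" and "i \<le> m"
  shows "continuous_on (natural_iterate_domain D f m) (f ^^ i)"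
  using \<open>i \<le> m\<close>
proof (induction i)
  case 0
  then show ?case by simp
next
  case (Suc i)
  then show ?case
    unfolding funpow.simps
    by (intro continuous_on_compose Suc.IH continuous_on_subset[OF assms(1)])
      (auto simp: natural_iterate_domain_def)
qed

theorem theorem2p2:
  fixes A :: "'a::chilbert_space \<Rightarrow> 'a"
    and E :: "complex set \<Rightarrow> 'a \<Rightarrow> 'a"
    and U :: "complex set"
    and K :: nat
    and p :: "nat \<Rightarrow> complex \<Rightarrow> complex"
    and f :: "complex \<Rightarrow> complex"
    and Am :: "nat \<Rightarrow> 'a \<Rightarrow> 'a"
  assumes normal: "normal_op A"
    and spectral_measure: "spectral_measure_of A E"
    and U: "open U" "op_spectrum A \<subseteq> U"
    and K: "1 \<le> K"
    and hol: "\<And>k. k \<in> {1..K} \<Longrightarrow> p k holomorphic_on U"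
    and bound: "\<And>k. k \<in> {1..K} \<Longrightarrow> sup_norm_on (op_spectrum A) (p k) \<le> 1"
    and f: "f = comp_chain p K"
    and compositions_defined: "\<And>m. 1 \<le> m \<Longrightarrow>
      \<exists>V. open V \<and> op_spectrum A \<subseteq> V \<and> V \<subseteq> natural_iterate_domain (comp_chain_dom U p K) f m"
    and Am: "\<And>m. Am m = borel_calculus A E (f ^^ m)"
  shows "(\<forall>m\<ge>1. op_spectrum (Am m) = op_spectrum (borel_calculus A E (f ^^ m)) \<and>
            op_spectrum (borel_calculus A E (f ^^ m)) = (f ^^ m) ` op_spectrum A) \<and>
         (\<forall>chi :: complex \<Rightarrow> complex.
            (\<forall>l\<in>op_spectrum A. (\<lambda>m. (f ^^ m) l) \<longlonglongrightarrow> chi l) \<longrightarrow>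
            (SUP m\<in>{1..}. sup_norm_on (op_spectrum A) (f ^^ m)) < \<infinity> \<longrightarrow>
            (let Aw = borel_calculus A E chi in
               bounded_clinear Aw \<and>
               strong_op_limit Am Aw \<and>
               op_spectrum Aw \<subseteq> closure (chi ` op_spectrum A) \<and>
               (chi ` op_spectrum A \<subseteq> {0, 1} \<longrightarrow>
                  orth_projection Aw \<and>
                  op_spectrum Aw \<subseteq> {0, 1} \<and>
                  (Aw \<noteq> (\<lambda>x. 0) \<and> Aw \<noteq> id \<longrightarrow> op_spectrum Aw = {0, 1}))))"
proof -
  let ?\<sigma> = "op_spectrum A" and ?M = "spectral_borel A"
  have A: "bounded_clinear A" using normal by (simp add: normal_op_def)
  have comp: "compact ?\<sigma>" by (rule compact_op_spectrum[OF A])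
  have space: "space ?M = ?\<sigma>" by (simp add: spectral_borel_def space_restrict_space)
  interpret pvm ?M E
    using spectral_measure by unfold_locales (simp add: spectral_measure_of_def)
  \<comment> \<open>Compactness of the spectrum makes continuous functions bounded there, so the
    calculus applies to them.\<close>
  have bm: "bounded_measurable g" if "continuous_on ?\<sigma> g" for g
  proof -
    have "bounded (g ` ?\<sigma>)"
      using compact_continuous_image[OF that comp] by (rule compact_imp_bounded)
    moreover have "g \<in> borel_measurable ?M"
      unfolding spectral_borel_def by (rule borel_measurable_continuous_on_restrict[OF that])
    ultimately show ?thesis by (auto simp: bounded_measurable_def space bounded_iff)
  qed
  have \<Phi>_id: "\<Phi> (\<lambda>z. z) = A"
    using spectral_measure by (simp add: spectral_measure_of_def borel_calculus_def)
  have spec_map: "op_spectrum (\<Phi> g) = g ` ?\<sigma>" if g: "continuous_on ?\<sigma> g" for g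
  proof
    show "op_spectrum (\<Phi> g) \<subseteq> g ` ?\<sigma>"
      using op_spectrum_\<Phi>_subset[OF bm[OF g]] compact_continuous_image[OF g comp]
      by (simp add: space compact_imp_closed)
    show "g ` ?\<sigma> \<subseteq> op_spectrum (\<Phi> g)"
    proof
      fix w assume "w \<in> g ` ?\<sigma>"
      then obtain z where z: "z \<in> ?\<sigma>" "w = g z" by auto
      show "w \<in> op_spectrum (\<Phi> g)"
      proof (rule op_spectrum_\<Phi>I[OF bm[OF g]])
        fix e :: real assume "0 < e"
        then obtain d where d: "0 < d" "\<And>l. l \<in> ?\<sigma> \<Longrightarrow> dist l z < d \<Longrightarrow> dist (g l) (g z) < e"
          using g z(1) unfolding continuous_on_iff by metis
        \<comment> \<open>The lemma is applied to the identity function, whose operator is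
          \<open>A\<close>; on this set continuity keeps \<open>g\<close> within \<open>e\<close> of
          \<open>w\<close>.\<close>
        have "\<exists>x. E ((\<lambda>z. z) -` ball z d \<inter> space ?M) x \<noteq> 0"
          by (rule E_nonzero_near_spectrum) (use z d(1) in \<open>auto simp: \<Phi>_id intro!: bm\<close>)
        moreover have "(\<lambda>z. z) -` ball z d \<inter> space ?M \<in> sets ?M"
          by (rule measurable_sets[OF bounded_measurable_borel[OF bm]]) auto
        ultimately show "\<exists>S\<in>sets ?M. (\<exists>x. E S x \<noteq> 0) \<and> (\<forall>l\<in>S. cmod (g l - w) \<le> e)"
          using d(2) by (intro bexI[of _ "(\<lambda>z. z) -` ball z d \<inter> space ?M"])
            (auto simp: space z(2) dist_norm norm_minus_commute less_imp_le)
      qed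
    qed
  qed
  have cont: "continuous_on ?\<sigma> (f ^^ m)" for m
  \<comment> \<open>The neighbourhoods are given for \<open>m \<ge> 1\<close>; the zeroth iterate is
    the identity.\<close>
  proof (cases "m = 0")
    case False
    then obtain V where "?\<sigma> \<subseteq> V" "V \<subseteq> natural_iterate_domain (comp_chain_dom U p K) f m"
      using compositions_defined[of m] by auto
    moreover have "continuous_on (comp_chain_dom U p K) f"
      unfolding f by (intro continuous_on_comp_chain holomorphic_on_imp_continuous_on hol) auto
    ultimately show ?thesis
      by (meson continuous_on_funpow continuous_on_subset order_refl)
  qed simp
  have "bounded_clinear (\<Phi> chi) \<and> strong_op_limit Am (\<Phi> chi) \<and>
      op_spectrum (\<Phi> chi) \<subseteq> closure (chi ` ?\<sigma>) \<and>
      (chi ` ?\<sigma> \<subseteq> {0, 1} \<longrightarrow> orth_projection (\<Phi> chi) \<and> op_spectrum (\<Phi> chi) \<subseteq> {0, 1} \<and>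
         (\<Phi> chi \<noteq> (\<lambda>x. 0) \<and> \<Phi> chi \<noteq> id \<longrightarrow> op_spectrum (\<Phi> chi) = {0, 1}))"
    if lim: "\<forall>l\<in>?\<sigma>. (\<lambda>m. (f ^^ m) l) \<longlonglongrightarrow> chi l"
      and fin: "(SUP m\<in>{1..}. sup_norm_on ?\<sigma> (f ^^ m)) < \<infinity>" for chi
  proof -
    obtain C where C: "0 \<le> C" "(SUP m\<in>{1..}. sup_norm_on ?\<sigma> (f ^^ m)) = ennreal C"
      using fin unfolding infinity_ennreal_def less_top_ennreal by blast
    \<comment> \<open>The supremum starts at exponent 1, so the bound and the convergence argument
      use \<open>f ^^ Suc m\<close>; the shift is undone when passing back to
      \<open>Am\<close>.\<close>
    have le: "cmod ((f ^^ Suc m) l) \<le> C" if "l \<in> ?\<sigma>" for m l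
    proof -
      have "ennreal (cmod ((f ^^ Suc m) l)) \<le> sup_norm_on ?\<sigma> (f ^^ Suc m)"
        unfolding sup_norm_on_def using that by (rule SUP_upper)
      also have "\<dots> \<le> ennreal C"
        unfolding C(2)[symmetric] by (rule SUP_upper) simp
      finally show ?thesis using C(1) by (simp del: funpow.simps)
    qed
    have lim': "(\<lambda>m. (f ^^ Suc m) l) \<longlonglongrightarrow> chi l" if "l \<in> ?\<sigma>" for l
      using lim that by (intro LIMSEQ_Suc) blast
    \<comment> \<open>As a pointwise limit on the spectrum, \<open>chi\<close> inherits
      measurability and the bound \<open>C\<close>.\<close>
    have chi: "bounded_measurable chi"
    proof (rule bounded_measurableI)
      show "chi \<in> borel_measurable ?M"
        by (rule borel_measurable_LIMSEQ_metric[where f = "\<lambda>m. f ^^ m"])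
          (use lim cont bm bounded_measurable_borel space in auto)
      show "cmod (chi l) \<le> C" if "l \<in> space ?M" for l
        using that le lim'[of l] unfolding space
        by (intro Lim_bounded[OF tendsto_norm, of "\<lambda>m. (f ^^ Suc m) l" _ 0]) blast+
    qed
    have "(\<lambda>m. \<Phi> (f ^^ Suc m) x) \<longlonglongrightarrow> \<Phi> chi x" for x
      by (rule \<Phi>_strong_limit[OF bm[OF cont] chi]) (use lim' le space in blast)+
    then have "(\<lambda>m. Am m x) \<longlonglongrightarrow> \<Phi> chi x" for x
      unfolding Am borel_calculus_def by (rule LIMSEQ_imp_Suc)
    then have strong: "strong_op_limit Am (\<Phi> chi)" by (simp add: strong_op_limit_def)
    have sub: "op_spectrum (\<Phi> chi) \<subseteq> closure (chi ` ?\<sigma>)"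
      using op_spectrum_\<Phi>_subset[OF chi] by (simp add: space)
    {
      assume 01: "chi ` ?\<sigma> \<subseteq> {0, 1}"
      have P: "orth_projection (\<Phi> chi)"
        by (rule \<Phi>_orth_projection[OF chi]) (use 01 space in auto)
      have "closure (chi ` ?\<sigma>) \<subseteq> {0, 1}"
        using 01 by (intro closure_minimal) (auto intro: finite_imp_closed)
      with sub have "op_spectrum (\<Phi> chi) \<subseteq> {0, 1}" by blast
      with P op_spectrum_projection[OF P]
      have "orth_projection (\<Phi> chi) \<and> op_spectrum (\<Phi> chi) \<subseteq> {0, 1} \<and>
         (\<Phi> chi \<noteq> (\<lambda>x. 0) \<and> \<Phi> chi \<noteq> id \<longrightarrow> op_spectrum (\<Phi> chi) = {0, 1})"
        by blast
    }
    with \<Phi>_clinear[OF chi] strong sub show ?thesis by blast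
  qed
  with spec_map[OF cont] show ?thesis
    unfolding Let_def Am borel_calculus_def by blast
qed

end
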